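(* Let $\mathcal{M}_{A\to BD}$ and $\mathcal{R}_{D\to E}$ be quantum channels, let $\mathcal{N}_{A\to BE}=\mathcal{R}_{D\to E}\circ\mathcal{M}_{A\to BD}$, let $\mathcal{M}_{A\to B}=\operatorname{Tr}_D\circ\mathcal{M}_{A\to BD}$, and let $\eta_{\mathcal{R}}=\eta^\Delta_D(\mathcal{R}_{D\to E})$. Then $$\eta_{\mathrm{MI}}(\mathcal{N}_{A\to BE})\leq\eta_{\mathcal{R}}\cdot\eta_{\mathrm{MI}}(\mathcal{M}_{A\to BD})+(1-\eta_{\mathcal{R}})\cdot\eta_{\mathrm{MI}}(\mathcal{M}_{A\to B}),$$ $$\eta_D(\mathcal{N}_{A\to BE})\leq\eta_{\mathcal{R}}\cdot\eta_D(\mathcal{M}_{A\to BD})+(1-\eta_{\mathcal{R}})\cdot\eta_D(\mathcal{M}_{A\to B}).$$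
   Context: All systems are finite-dimensional. A channel acts as the identity on systems not in its input. $D(\rho\|\sigma)=\operatorname{Tr}[\rho(\log\rho-\log\sigma)]$ if $\operatorname{supp}(\rho)\subseteq\operatorname{supp}(\sigma)$, else $+\infty$; $I(A:B)=D(\rho_{AB}\|\rho_A\otimes\rho_B)$. All ratio optimizations are over states with strictly positive and finite denominator (value $0$ if there are none). For a channel $\mathcal{T}\colon A\to B$: $$\eta_D(\mathcal{T})=\sup_{\rho_A\neq\sigma_A}\frac{D(\mathcal{T}(\rho_A)\|\mathcal{T}(\sigma_A))}{D(\rho_A\|\sigma_A)},\qquad \eta_{\mathrm{MI}}(\mathcal{T})=\sup_{C,\ \rho_{CA}}\frac{I(C:B)_{\mathcal{T}(\rho)}}{I(C:A)_\rho},$$ $$\eta^\Delta_D(\mathcal{T})=\sup_{R,\ \rho_{RA},\sigma_{RA}}\frac{D(\mathcal{T}(\rho_{RA})\|\mathcal{T}(\sigma_{RA}))-D(\rho_R\|\sigma_R)}{D(\rho_{RA}\|\sigma_{RA})-D(\rho_R\|\sigma_R)},$$ where $C$ and $R$ range over all finite-dimensional quantum systems. *)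

theory Defs
  imports
    Complex_Main
    "HOL-Library.Extended_Real"
    "Jordan_Normal_Form.Matrix_Kernel"
    "Jordan_Normal_Form.Schur_Decomposition"
begin

text \<open>
  A finite-dimensional system is represented by its dimension \<open>n\<close>, its operators by
  \<open>carrier_mat n n\<close> over the complex numbers. The composite \<open>X \<otimes> Y\<close> of systems of dimensions
  \<open>x\<close> and \<open>y\<close> has dimension \<open>x * y\<close>, the basis vector \<open>i \<otimes> j\<close> having index \<open>i * y + j\<close>. With this
  convention the tensor product is strictly associative, so no reindexing is needed for
  composites of three systems.
\<close>

subsection \<open>Operators and states\<close>

definition mat_trace :: "complex mat \<Rightarrow> complex" where
  "mat_trace A = (\<Sum>i<dim_row A. A $$ (i, i))"

definition unitary :: "nat \<Rightarrow> complex mat \<Rightarrow> bool" where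
  "unitary n U \<longleftrightarrow> U \<in> carrier_mat n n \<and> mat_adjoint U * U = 1\<^sub>m n"

definition psd :: "nat \<Rightarrow> complex mat \<Rightarrow> bool" where
  "psd n A \<longleftrightarrow> A \<in> carrier_mat n n \<and> mat_adjoint A = A \<and>
     (\<forall>v \<in> carrier_vec n. 0 \<le> Re ((A *\<^sub>v v) \<bullet>c v))"

definition state :: "nat \<Rightarrow> complex mat \<Rightarrow> bool" where
  "state n \<rho> \<longleftrightarrow> psd n \<rho> \<and> mat_trace \<rho> = 1"

text \<open>The functional calculus of a Hermitian matrix, via a unitary diagonalisation; the result
  does not depend on which diagonalisation is used.\<close>

definition herm_fun :: "(real \<Rightarrow> real) \<Rightarrow> complex mat \<Rightarrow> complex mat" where
  "herm_fun f A = (THE B. \<exists>U d. unitary (dim_row A) U \<and>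
     A = U * mat_diag (dim_row A) (\<lambda>i. complex_of_real (d i)) * mat_adjoint U \<and>
     B = U * mat_diag (dim_row A) (\<lambda>i. complex_of_real (f (d i))) * mat_adjoint U)"

text \<open>The logarithm is taken on the support and extended by \<open>0\<close> to the kernel.\<close>

definition mat_log :: "complex mat \<Rightarrow> complex mat" where
  "mat_log = herm_fun (\<lambda>x. if x > 0 then ln x else 0)"

definition mat_supp :: "complex mat \<Rightarrow> complex vec set" where
  "mat_supp A = {v \<in> carrier_vec (dim_col A). \<forall>w \<in> mat_kernel A. v \<bullet>c w = 0}"

subsection \<open>Composite systems\<close>

definition tensor_mat :: "complex mat \<Rightarrow> complex mat \<Rightarrow> complex mat" where
  "tensor_mat A B = mat (dim_row A * dim_row B) (dim_col A * dim_col B)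
     (\<lambda>(i, j). A $$ (i div dim_row B, j div dim_col B) * B $$ (i mod dim_row B, j mod dim_col B))"

text \<open>In both partial traces the operator lives on \<open>X \<otimes> Y\<close>; the first one traces out \<open>X\<close>,
  the second one \<open>Y\<close>.\<close>

definition ptrace_fst :: "nat \<Rightarrow> nat \<Rightarrow> complex mat \<Rightarrow> complex mat" where
  "ptrace_fst x y Z = mat y y (\<lambda>(k, l). \<Sum>i<x. Z $$ (i * y + k, i * y + l))"

definition ptrace_snd :: "nat \<Rightarrow> nat \<Rightarrow> complex mat \<Rightarrow> complex mat" where
  "ptrace_snd x y Z = mat x x (\<lambda>(i, j). \<Sum>k<y. Z $$ (i * y + k, j * y + k))"

text \<open>The map \<open>id \<otimes> T\<close> on \<open>R \<otimes> A\<close> with \<open>T\<close> from \<open>A\<close> to \<open>B\<close>, for systems of dimensions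
  \<open>r\<close>, \<open>a\<close>, \<open>b\<close>: an operator on \<open>R \<otimes> A\<close> is an \<open>r\<close> by \<open>r\<close> array of blocks of size \<open>a\<close>,
  and \<open>T\<close> is applied to each block.\<close>

definition id_tensor ::
  "nat \<Rightarrow> nat \<Rightarrow> nat \<Rightarrow> (complex mat \<Rightarrow> complex mat) \<Rightarrow> complex mat \<Rightarrow> complex mat" where
  "id_tensor r a b T Z = mat (r * b) (r * b)
     (\<lambda>(i, j). T (mat a a (\<lambda>(k, l). Z $$ ((i div b) * a + k, (j div b) * a + l)))
                 $$ (i mod b, j mod b))"

text \<open>Completely positive trace-preserving linear maps; the values of \<open>T\<close> outside
  \<open>carrier_mat a a\<close> are irrelevant.\<close>

definition channel :: "nat \<Rightarrow> nat \<Rightarrow> (complex mat \<Rightarrow> complex mat) \<Rightarrow> bool" where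
  "channel a b T \<longleftrightarrow>
     (\<forall>X \<in> carrier_mat a a. T X \<in> carrier_mat b b) \<and>
     (\<forall>X \<in> carrier_mat a a. \<forall>Y \<in> carrier_mat a a. T (X + Y) = T X + T Y) \<and>
     (\<forall>c. \<forall>X \<in> carrier_mat a a. T (c \<cdot>\<^sub>m X) = c \<cdot>\<^sub>m T X) \<and>
     (\<forall>X \<in> carrier_mat a a. mat_trace (T X) = mat_trace X) \<and>
     (\<forall>r Z. psd (r * a) Z \<longrightarrow> psd (r * b) (id_tensor r a b T Z))"

subsection \<open>Information measures\<close>

definition rel_entropy :: "complex mat \<Rightarrow> complex mat \<Rightarrow> ereal" where
  "rel_entropy \<rho> \<sigma> = (if mat_supp \<rho> \<subseteq> mat_supp \<sigma>
     then ereal (Re (mat_trace (\<rho> * (mat_log \<rho> - mat_log \<sigma>)))) else \<infinity>)"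

definition mutual_info :: "nat \<Rightarrow> nat \<Rightarrow> complex mat \<Rightarrow> ereal" where
  "mutual_info x y \<rho> = rel_entropy \<rho> (tensor_mat (ptrace_snd x y \<rho>) (ptrace_fst x y \<rho>))"

subsection \<open>Contraction coefficients\<close>

text \<open>\<open>P\<close> is a set of pairs (numerator, denominator). In \<^typ>\<open>ereal\<close> we have \<open>\<infinity> - \<infinity> = \<infinity>\<close>, so
  a denominator that is a difference is finite and positive only if both of its terms are
  finite.\<close>

definition sup_ratio :: "(ereal \<times> ereal) set \<Rightarrow> ereal" where
  "sup_ratio P = (let S = {p / q | p q. (p, q) \<in> P \<and> 0 < q \<and> q < \<infinity>}
     in if S = {} then 0 else Sup S)"

definition eta_D :: "nat \<Rightarrow> (complex mat \<Rightarrow> complex mat) \<Rightarrow> ereal" where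
  "eta_D a T = sup_ratio {(rel_entropy (T \<rho>) (T \<sigma>), rel_entropy \<rho> \<sigma>) | \<rho> \<sigma>.
     state a \<rho> \<and> state a \<sigma> \<and> \<rho> \<noteq> \<sigma>}"

definition eta_MI :: "nat \<Rightarrow> nat \<Rightarrow> (complex mat \<Rightarrow> complex mat) \<Rightarrow> ereal" where
  "eta_MI a b T = sup_ratio {(mutual_info c b (id_tensor c a b T \<rho>), mutual_info c a \<rho>) | c \<rho>.
     0 < c \<and> state (c * a) \<rho>}"

definition eta_Delta :: "nat \<Rightarrow> nat \<Rightarrow> (complex mat \<Rightarrow> complex mat) \<Rightarrow> ereal" where
  "eta_Delta a b T = sup_ratio
     {(rel_entropy (id_tensor r a b T \<rho>) (id_tensor r a b T \<sigma>)
         - rel_entropy (ptrace_snd r a \<rho>) (ptrace_snd r a \<sigma>),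
       rel_entropy \<rho> \<sigma> - rel_entropy (ptrace_snd r a \<rho>) (ptrace_snd r a \<sigma>)) | r \<rho> \<sigma>.
     0 < r \<and> state (r * a) \<rho> \<and> state (r * a) \<sigma>}"

end

theory Submission
  imports Defs "Jordan_Normal_Form.Spectral_Radius"
begin

text \<open>
  If \<open>\<rho>' = M(\<rho>)\<close> and \<open>\<sigma>' = M(\<sigma>)\<close>, the definition of \<open>\<eta>\<^sub>R\<close> with reference system \<open>B\<close> bounds
  \<open>D(R(\<rho>') \<parallel> R(\<sigma>'))\<close> by \<open>\<eta>\<^sub>R D(\<rho>' \<parallel> \<sigma>') + (1 - \<eta>\<^sub>R) D(\<rho>'\<^sub>B \<parallel> \<sigma>'\<^sub>B)\<close>; the two terms are then bounded by
  the contraction coefficients of \<open>M\<close> and of \<open>Tr\<^sub>D \<circ> M\<close>. The mutual information is the case where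
  \<open>\<sigma>\<close> is the product of the marginals and the reference is \<open>CB\<close>. The argument needs
  \<open>0 \<le> \<eta>\<^sub>R \<le> 1\<close>, and the case of a vanishing denominator needs \<open>D(R(\<rho>') \<parallel> R(\<sigma>')) \<le> D(\<rho>' \<parallel> \<sigma>')\<close>; both
  are instances of the data processing inequality.

  For the data processing inequality let \<open>\<rho>\<close>, \<open>\<sigma>\<close> have eigenvalues \<open>p\<^sub>i\<close>, \<open>q\<^sub>j\<close> and squared eigenvector
  overlaps \<open>w\<^sub>i\<^sub>j\<close>. The function \<open>H(t) = \<Sum> w\<^sub>i\<^sub>j q\<^sub>j ln (p\<^sub>i + t q\<^sub>j)\<close> tends to \<open>Tr \<sigma> ln \<rho>\<close> as \<open>t\<close> tends to \<open>0\<close>,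
  and \<open>H(t) - ln t\<close> tends to \<open>Tr \<sigma> ln \<sigma>\<close> at infinity. Its derivative \<open>\<Sum> w\<^sub>i\<^sub>j q\<^sub>j\<^sup>2 / (p\<^sub>i + t q\<^sub>j)\<close> is the supremum over
  all \<open>X\<close> of \<open>2 Re Tr \<sigma>X - Tr \<rho>XX\<^sup>* - t Tr \<sigma>X\<^sup>*X\<close>, and this quadratic form decreases under a
  channel: inserting the dual of the channel, \<open>X = \<Psi>(Y)\<close>, gives an upper bound for its value at \<open>Y\<close>
  by the Kadison--Schwarz inequality.
\<close>

subsection \<open>Adjoints and traces\<close>

lemma mat_adjoint_dim [simp]:
  "dim_row (mat_adjoint A) = dim_col A" "dim_col (mat_adjoint A) = dim_row A"
  unfolding mat_adjoint_def by auto

lemma mat_adjoint_carrier [simp]: "mat_adjoint A \<in> carrier_mat m n \<longleftrightarrow> A \<in> carrier_mat n m"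
  by (metis carrier_matD carrier_matI mat_adjoint_dim)

lemma mult_mat_carrier_iff [simp]: "A * B \<in> carrier_mat n m \<longleftrightarrow> dim_row A = n \<and> dim_col B = m"
  by (metis carrier_matD carrier_matI index_mult_mat(2,3))

lemma mat_diag_dims [simp]: "dim_row (mat_diag n f) = n" "dim_col (mat_diag n f) = n"
  by (auto simp: mat_diag_def)

lemma mult_mat_vec_carrier_iff [simp]: "A *\<^sub>v v \<in> carrier_vec n \<longleftrightarrow> dim_row A = n"
  by (metis carrier_vecD carrier_vecI dim_mult_mat_vec)

lemma mat_adjoint_index [simp]:
  fixes A :: "complex mat"
  assumes "i < dim_col A" "j < dim_row A"
  shows "mat_adjoint A $$ (i, j) = cnj (A $$ (j, i))"
  using assms unfolding mat_adjoint_def by (simp add: mat_of_rows_def)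

lemma index_mult_mat_sum:
  fixes A B :: "'a :: comm_semiring_0 mat"
  assumes "A \<in> carrier_mat n k" "B \<in> carrier_mat k m" "i < n" "j < m"
  shows "(A * B) $$ (i, j) = (\<Sum>l<k. A $$ (i, l) * B $$ (l, j))"
  using assms by (auto simp: scalar_prod_def atLeast0LessThan intro!: sum.cong)

lemma mat_adjoint_adjoint [simp]: "mat_adjoint (mat_adjoint A) = (A :: complex mat)"
  by (rule eq_matI) auto

lemma mat_adjoint_mult:
  fixes A B :: "complex mat"
  assumes "A \<in> carrier_mat n k" "B \<in> carrier_mat k m"
  shows "mat_adjoint (A * B) = mat_adjoint B * mat_adjoint A"
proof (rule eq_matI)
  fix i j assume "i < dim_row (mat_adjoint B * mat_adjoint A)" "j < dim_col (mat_adjoint B * mat_adjoint A)"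
  then have ij: "i < m" "j < n" using assms by auto
  have "mat_adjoint (A * B) $$ (i, j) = cnj (\<Sum>l<k. A $$ (j, l) * B $$ (l, i))"
    using ij assms by (simp add: index_mult_mat_sum[OF assms ij(2,1)] del: index_mult_mat(1))
  also have "\<dots> = (\<Sum>l<k. mat_adjoint B $$ (i, l) * mat_adjoint A $$ (l, j))"
    using ij assms by (auto intro!: sum.cong simp: mult.commute)
  also have "\<dots> = (mat_adjoint B * mat_adjoint A) $$ (i, j)"
    using ij assms by (intro index_mult_mat_sum[symmetric]) auto
  finally show "mat_adjoint (A * B) $$ (i, j) = (mat_adjoint B * mat_adjoint A) $$ (i, j)" .
qed (use assms in auto)

lemma mat_trace_mult:
  assumes "A \<in> carrier_mat n k" "B \<in> carrier_mat k n"
  shows "mat_trace (A * B) = (\<Sum>i<n. \<Sum>j<k. A $$ (i, j) * B $$ (j, i))"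
  unfolding mat_trace_def using assms
  by (auto intro!: sum.cong simp: index_mult_mat_sum simp del: index_mult_mat(1))

lemma mat_trace_comm:
  assumes "A \<in> carrier_mat n k" "B \<in> carrier_mat k n"
  shows "mat_trace (A * B) = mat_trace (B * A)"
  using assms by (simp add: mat_trace_mult mult.commute sum.swap[of _ "{..<n}"])

lemma mat_trace_add:
  assumes "A \<in> carrier_mat n n" "B \<in> carrier_mat n n"
  shows "mat_trace (A + B) = mat_trace A + mat_trace B"
  using assms by (auto simp: mat_trace_def sum.distrib)

lemma mat_trace_minus:
  assumes "A \<in> carrier_mat n n" "B \<in> carrier_mat n n"
  shows "mat_trace (A - B) = mat_trace A - mat_trace B"
  using assms by (auto simp: mat_trace_def sum_subtractf)

lemma mat_trace_smult:
  assumes "A \<in> carrier_mat n n"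
  shows "mat_trace (c \<cdot>\<^sub>m A) = c * mat_trace A"
  using assms by (auto simp: mat_trace_def sum_distrib_left)

lemma mat_trace_adjoint:
  assumes "A \<in> carrier_mat n n"
  shows "mat_trace (mat_adjoint A) = cnj (mat_trace A)"
  using assms by (auto simp: mat_trace_def)

lemma cscalar_prod_sum:
  assumes "v \<in> carrier_vec n" "w \<in> carrier_vec n"
  shows "v \<bullet>c w = (\<Sum>i<n. v $ i * cnj (w $ i))"
  using assms by (auto simp: scalar_prod_def atLeast0LessThan intro!: sum.cong)

lemma index_mult_mat_vec_sum:
  assumes "A \<in> carrier_mat n m" "v \<in> carrier_vec m" "i < n"
  shows "(A *\<^sub>v v) $ i = (\<Sum>j<m. A $$ (i, j) * v $ j)"
  using assms by (auto simp: scalar_prod_def atLeast0LessThan intro!: sum.cong)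

lemma cscalar_prod_adjoint:
  fixes A :: "complex mat"
  assumes "A \<in> carrier_mat n m" "v \<in> carrier_vec m" "w \<in> carrier_vec n"
  shows "(A *\<^sub>v v) \<bullet>c w = v \<bullet>c (mat_adjoint A *\<^sub>v w)"
proof -
  have "(A *\<^sub>v v) \<bullet>c w = (\<Sum>i<n. \<Sum>j<m. A $$ (i, j) * v $ j * cnj (w $ i))"
    using assms by (subst cscalar_prod_sum[of _ n])
      (auto intro!: sum.cong simp: index_mult_mat_vec_sum sum_distrib_right simp del: index_mult_mat_vec)
  also have "\<dots> = (\<Sum>j<m. \<Sum>i<n. A $$ (i, j) * v $ j * cnj (w $ i))" by (rule sum.swap)
  also have "\<dots> = v \<bullet>c (mat_adjoint A *\<^sub>v w)"
    using assms by (subst cscalar_prod_sum[of _ m])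
      (auto intro!: sum.cong simp: index_mult_mat_vec_sum[of _ m n] sum_distrib_left mult_ac simp del: index_mult_mat_vec)
  finally show ?thesis .
qed

section \<open>Unitary matrices\<close>

lemma unitaryD:
  assumes "unitary n U"
  shows "U \<in> carrier_mat n n" "mat_adjoint U \<in> carrier_mat n n"
    "mat_adjoint U * U = 1\<^sub>m n" "U * mat_adjoint U = 1\<^sub>m n"
proof -
  show U: "U \<in> carrier_mat n n" and U2: "mat_adjoint U * U = 1\<^sub>m n"
    using assms unfolding unitary_def by auto
  then show "mat_adjoint U \<in> carrier_mat n n" by simp
  then show "U * mat_adjoint U = 1\<^sub>m n"
    using mat_mult_left_right_inverse U U2 by blast
qed

lemma unitary_adjoint: "unitary n U \<Longrightarrow> unitary n (mat_adjoint U)"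
  unfolding unitary_def[of n "mat_adjoint U"] using unitaryD[of n U] by auto

lemma unitary_mult:
  assumes "unitary n U" "unitary n V"
  shows "unitary n (U * V)"
proof -
  note U = unitaryD[OF assms(1)] and V = unitaryD[OF assms(2)]
  have "mat_adjoint (U * V) * (U * V) = mat_adjoint V * (mat_adjoint U * U) * V"
    using U(1,2) V(1,2) by (simp add: mat_adjoint_mult[of _ n n _ n] assoc_mult_mat[of _ n n _ n _ n])
  then show ?thesis unfolding unitary_def using U V by simp
qed

lemma unitary_row_norm:
  assumes "unitary n W" "i < n"
  shows "(\<Sum>j<n. (cmod (W $$ (i, j)))\<^sup>2) = 1"
proof -
  note W = unitaryD[OF assms(1)]
  have "(\<Sum>j<n. W $$ (i, j) * cnj (W $$ (i, j))) = (W * mat_adjoint W) $$ (i, i)"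
    using W(1,2) assms(2) by (auto simp: index_mult_mat_sum[of _ n n _ n] simp del: index_mult_mat(1))
  also have "\<dots> = 1" using W assms(2) by simp
  finally have "complex_of_real (\<Sum>j<n. (cmod (W $$ (i, j)))\<^sup>2) = of_real 1"
    by (simp add: complex_norm_square del: of_real_power)
  then show ?thesis using of_real_eq_iff by blast
qed

lemma unitary_col_norm:
  assumes "unitary n W" "j < n"
  shows "(\<Sum>i<n. (cmod (W $$ (i, j)))\<^sup>2) = 1"
  using unitary_row_norm[OF unitary_adjoint[OF assms(1)] assms(2)] unitaryD(1)[OF assms(1)] assms(2)
  by simp

subsection \<open>Spectral decomposition\<close>

lemma hermitian_eigenvalue_real:
  assumes A: "A \<in> carrier_mat n n" "mat_adjoint A = A"
    and v: "v \<in> carrier_vec n" "v \<noteq> 0\<^sub>v n" "A *\<^sub>v v = e \<cdot>\<^sub>v v"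
  shows "cnj e = e"
proof -
  have "e * (v \<bullet>c v) = (A *\<^sub>v v) \<bullet>c v" using v by simp
  also have "\<dots> = v \<bullet>c (A *\<^sub>v v)" using cscalar_prod_adjoint[OF A(1) v(1) v(1)] A by simp
  also have "\<dots> = cnj e * (v \<bullet>c v)" using v by (simp add: conjugate_smult_vec)
  finally show ?thesis using v(1,2) by simp
qed

text \<open>Complete \<open>v\<close> to a basis and orthogonalise by Gram--Schmidt, which leaves
  the first vector unchanged. Normalising the columns makes \<open>c\<close> the reciprocal of the
  norm of \<open>v\<close>.\<close>

lemma unitary_with_first_column:
  fixes v :: "complex vec"
  assumes v: "v \<in> carrier_vec n" "v \<noteq> 0\<^sub>v n" and n: "0 < n"
  obtains U c where "unitary n U" "c \<noteq> 0" "col U 0 = c \<cdot>\<^sub>v v"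
proof -
  interpret cof_vec_space n "TYPE(complex)" .
  define b where "b = basis_completion v"
  define ws where "ws = gram_schmidt n b"
  from basis_completion[OF v, folded b_def]
  have b: "distinct b" "\<not> lin_dep (set b)" "set b \<subseteq> carrier_vec n" "hd b = v" "length b = n" by auto
  then obtain vs where bv: "b = v # vs" using n by (cases b) auto
  from gram_schmidt_result[OF b(3) b(1) b(2) refl, folded ws_def]
  have ws: "set ws \<subseteq> carrier_vec n" "corthogonal ws" "length ws = n" by (auto simp: b)
  have hd: "hd ws = v" using gram_schmidt_hd[OF v(1), of vs] unfolding ws_def bv .
  have wsc: "ws ! i \<in> carrier_vec n" if "i < n" for i using ws that by auto
  define s where "s i = Re (ws ! i \<bullet>c ws ! i)" for i
  have s: "ws ! i \<bullet>c ws ! i = of_real (s i)" "s i > 0" if "i < n" for i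
  proof -
    have "ws ! i \<bullet>c ws ! i = (\<Sum>k<n. of_real ((cmod (ws ! i $ k))\<^sup>2))"
      using cscalar_prod_sum[OF wsc[OF that] wsc[OF that]] by (simp add: complex_norm_square del: of_real_power)
    then have e: "ws ! i \<bullet>c ws ! i = of_real (\<Sum>k<n. ((cmod (ws ! i $ k))\<^sup>2))" by simp
    then show e2: "ws ! i \<bullet>c ws ! i = of_real (s i)" unfolding s_def by simp
    have "ws ! i \<bullet>c ws ! i \<noteq> 0" using corthogonalD[OF ws(2), of i i] ws(3) that by simp
    then have "s i \<noteq> 0" using e2 by auto
    moreover have "s i \<ge> 0" unfolding s_def e by (simp add: sum_nonneg)
    ultimately show "s i > 0" by simp
  qed
  define U where "U = mat n n (\<lambda>(k, i). ws ! i $ k / of_real (sqrt (s i)))"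
  have U: "U \<in> carrier_mat n n" by (simp add: U_def)
  have "mat_adjoint U * U = 1\<^sub>m n"
  proof (rule eq_matI)
    fix i j assume "i < dim_row (1\<^sub>m n)" "j < dim_col (1\<^sub>m n)"
    then have ij: "i < n" "j < n" by auto
    have "(mat_adjoint U * U) $$ (i, j) = (\<Sum>k<n. cnj (U $$ (k, i)) * U $$ (k, j))"
      using U ij by (auto simp: index_mult_mat_sum[of _ n n _ n] simp del: index_mult_mat(1))
    also have "\<dots> = (\<Sum>k<n. (ws ! j $ k * cnj (ws ! i $ k)) / (of_real (sqrt (s i)) * of_real (sqrt (s j))))"
      using ij by (intro sum.cong) (auto simp: U_def)
    also have "\<dots> = (ws ! j \<bullet>c ws ! i) / (of_real (sqrt (s i)) * of_real (sqrt (s j)))"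
      using cscalar_prod_sum[OF wsc[OF ij(2)] wsc[OF ij(1)]] by (simp add: sum_divide_distrib)
    also have "\<dots> = 1\<^sub>m n $$ (i, j)"
    proof (cases "i = j")
      case True
      have "complex_of_real (sqrt (s i)) * of_real (sqrt (s i)) = of_real (s i)"
        using s(2)[OF ij(1)] by (metis of_real_mult less_imp_le real_sqrt_mult_self abs_of_nonneg)
      then show ?thesis using True s[OF ij(1)] ij by simp
    next
      case False
      then have "ws ! j \<bullet>c ws ! i = 0" using corthogonalD[OF ws(2), of j i] ws(3) ij by simp
      then show ?thesis using False ij by simp
    qed
    finally show "(mat_adjoint U * U) $$ (i, j) = 1\<^sub>m n $$ (i, j)" .
  qed (use U in auto)
  then have "unitary n U" using U unfolding unitary_def by simp
  moreover have "complex_of_real (1 / sqrt (s 0)) \<noteq> 0" using s[OF n] by simp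
  moreover have "col U 0 = complex_of_real (1 / sqrt (s 0)) \<cdot>\<^sub>v v"
  proof -
    have "ws ! 0 = v" using hd ws(3) n by (metis hd_conv_nth list.size(3) less_irrefl)
    then show ?thesis using n v by (intro eq_vecI) (auto simp: U_def)
  qed
  ultimately show ?thesis by (rule that)
qed

text \<open>Induction on the dimension. A unitary whose first column is an eigenvector splits off a
  1 by 1 block: the eigenvector equation clears the first column, Hermiticity clears the first row,
  and the induction hypothesis diagonalises the remaining block.\<close>

theorem hermitian_diagonalization:
  assumes "A \<in> carrier_mat n n" "mat_adjoint A = A"
  shows "\<exists>U d. unitary n U \<and> A = U * mat_diag n (\<lambda>i. complex_of_real (d i)) * mat_adjoint U"
  using assms
proof (induction n arbitrary: A)
  case 0
  have "unitary 0 (1\<^sub>m 0)" by (auto simp: unitary_def)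
  moreover have "A = 1\<^sub>m 0 * mat_diag 0 (\<lambda>i. complex_of_real (0 :: real)) * mat_adjoint (1\<^sub>m 0)"
    using 0 by (intro eq_matI) auto
  ultimately show ?case by (intro exI[of _ "1\<^sub>m 0"] exI[of _ "\<lambda>_. 0"]) simp
next
  case (Suc n)
  let ?m = "Suc n"
  note A = Suc.prems
  obtain e where "e \<in> spectrum A" using spectrum_non_empty[OF A(1)] by auto
  then obtain v where v: "v \<in> carrier_vec ?m" "v \<noteq> 0\<^sub>v ?m" "A *\<^sub>v v = e \<cdot>\<^sub>v v"
    unfolding spectrum_def eigenvalue_def eigenvector_def using A by auto
  have e: "e = of_real (Re e)" using hermitian_eigenvalue_real[OF A v] complex_cnj_cancel_iff
    by (metis Reals_cnj_iff of_real_Re)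
  obtain W c where W: "unitary ?m W" and c: "c \<noteq> 0" "col W 0 = c \<cdot>\<^sub>v v"
    using unitary_with_first_column[OF v(1,2)] by blast
  note Wd = unitaryD[OF W]
  \<comment> \<open>\<open>B\<close> is \<open>A\<close> written in the orthonormal basis of columns
    of \<open>W\<close>, whose first member is proportional to the eigenvector
    \<open>v\<close>.\<close>
  define B where "B = mat_adjoint W * A * W"
  have B: "B \<in> carrier_mat ?m ?m" using Wd A unfolding B_def by simp
  have Bh: "mat_adjoint B = B" unfolding B_def
    using Wd A by (simp add: mat_adjoint_mult[of _ ?m ?m _ ?m] assoc_mult_mat[of _ ?m ?m _ ?m _ ?m])
  have col0: "B $$ (i, 0) = (if i = 0 then e else 0)" if "i < ?m" for i
  proof -
    have "A *\<^sub>v col W 0 = e \<cdot>\<^sub>v col W 0" unfolding c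
      using v A by (simp add: mult_mat_vec[of A ?m ?m] smult_smult_assoc mult.commute)
    then have AW: "(A * W) $$ (k, 0) = e * W $$ (k, 0)" if "k < ?m" for k
      using that A(1) Wd(1) by (auto dest!: arg_cong[of _ _ "\<lambda>w. w $ k"])
    have "B $$ (i, 0) = (\<Sum>k<?m. mat_adjoint W $$ (i, k) * (A * W) $$ (k, 0))"
      unfolding B_def assoc_mult_mat[OF Wd(2) A(1) Wd(1)]
      by (rule index_mult_mat_sum) (use that Wd(1) A(1) in auto)
    also have "\<dots> = e * (\<Sum>k<?m. mat_adjoint W $$ (i, k) * W $$ (k, 0))"
      unfolding sum_distrib_left by (intro sum.cong) (auto simp: AW simp del: index_mult_mat(1))
    also have "(\<Sum>k<?m. mat_adjoint W $$ (i, k) * W $$ (k, 0)) = (mat_adjoint W * W) $$ (i, 0)"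
      by (rule index_mult_mat_sum[symmetric, OF Wd(2,1)]) (use that in auto)
    finally show ?thesis using that Wd by simp
  qed
  have row0: "B $$ (0, j) = (if j = 0 then e else 0)" if "j < ?m" for j
  proof -
    have "B $$ (0, j) = mat_adjoint B $$ (0, j)" using Bh by simp
    also have "\<dots> = cnj (B $$ (j, 0))" using B that by (intro mat_adjoint_index) auto
    finally show ?thesis using col0[OF that] hermitian_eigenvalue_real[OF A v] by simp
  qed
  define B' where "B' = mat n n (\<lambda>(i, j). B $$ (Suc i, Suc j))"
  have B': "B' \<in> carrier_mat n n" by (simp add: B'_def)
  have "mat_adjoint B' = B'"
  proof (rule eq_matI)
    fix i j assume "i < dim_row B'" "j < dim_col B'"
    then have ij: "i < n" "j < n" by (auto simp: B'_def)
    have "mat_adjoint B $$ (Suc i, Suc j) = B $$ (Suc i, Suc j)" using Bh by simp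
    then show "mat_adjoint B' $$ (i, j) = B' $$ (i, j)" using ij B by (simp add: B'_def)
  qed (auto simp: B'_def)
  then obtain U d where U: "unitary n U" and d: "B' = U * mat_diag n (\<lambda>i. complex_of_real (d i)) * mat_adjoint U"
    using Suc.IH[OF B'] by blast
  note Ud = unitaryD[OF U]
  let ?D = "mat_diag n (\<lambda>i. complex_of_real (d i))"
  \<comment> \<open>\<open>V\<close> acts as \<open>U\<close> on the remaining block and fixes the
    basis vector that was split off; \<open>W * V\<close> then diagonalises
    \<open>A\<close>.\<close>
  define V where "V = four_block_mat (1\<^sub>m 1) (0\<^sub>m 1 n) (0\<^sub>m n 1) U"
  have V: "V \<in> carrier_mat ?m ?m" unfolding V_def
    using four_block_carrier_mat[of "1\<^sub>m 1" 1 1 U n n] Ud by simp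
  have Vadj: "mat_adjoint V = four_block_mat (1\<^sub>m 1) (0\<^sub>m 1 n) (0\<^sub>m n 1) (mat_adjoint U)"
    using Ud(1) by (intro eq_matI) (auto simp: V_def)
  have "mat_adjoint V * V = 1\<^sub>m ?m" unfolding Vadj unfolding V_def
    using Ud by (subst mult_four_block_mat[of _ 1 1 _ n _ n _ _ 1 _ n]) auto
  then have Vu: "unitary ?m V" using V unfolding unitary_def by simp
  define d' where "d' i = (case i of 0 \<Rightarrow> Re e | Suc k \<Rightarrow> d k)" for i
  have D': "mat_diag ?m (\<lambda>i. complex_of_real (d' i)) =
      four_block_mat (e \<cdot>\<^sub>m 1\<^sub>m 1) (0\<^sub>m 1 n) (0\<^sub>m n 1) ?D"
    using e by (intro eq_matI) (auto simp: mat_diag_def d'_def split: nat.splits)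
  have Bb: "B = four_block_mat (e \<cdot>\<^sub>m 1\<^sub>m 1) (0\<^sub>m 1 n) (0\<^sub>m n 1) B'"
    using B col0 row0 by (intro eq_matI) (auto simp: B'_def)
  have "B = V * mat_diag ?m (\<lambda>i. complex_of_real (d' i)) * mat_adjoint V"
    unfolding Vadj D' unfolding V_def Bb d using Ud(1,2)
    by (subst mult_four_block_mat[of _ 1 1 _ n _ n _ _ 1 _ n], auto)+
  moreover have "A = W * B * mat_adjoint W"
  proof -
    have "W * B * mat_adjoint W = (W * mat_adjoint W) * A * (W * mat_adjoint W)"
      unfolding B_def using Wd(1,2) A(1) by (simp add: assoc_mult_mat[of _ ?m ?m _ ?m _ ?m])
    then show ?thesis using Wd A by simp
  qed
  ultimately have "A = (W * V) * mat_diag ?m (\<lambda>i. complex_of_real (d' i)) * mat_adjoint (W * V)"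
    using Wd(1,2) V mat_diag_dim[of ?m "\<lambda>i. complex_of_real (d' i)"]
    by (simp add: mat_adjoint_mult[of _ ?m ?m _ ?m] assoc_mult_mat[of _ ?m ?m _ ?m _ ?m])
  then show ?case using unitary_mult[OF W Vu] by blast
qed

section \<open>Functional calculus\<close>

definition spectral :: "nat \<Rightarrow> complex mat \<Rightarrow> complex mat \<Rightarrow> (nat \<Rightarrow> real) \<Rightarrow> bool" where
  "spectral n A U d \<longleftrightarrow> unitary n U \<and> A = U * mat_diag n (\<lambda>i. complex_of_real (d i)) * mat_adjoint U"

lemma spectral_carrier: "spectral n A U d \<Longrightarrow> A \<in> carrier_mat n n"
  unfolding spectral_def using unitaryD(1,2)[of n U] mat_diag_dim[of n] by auto

text \<open>The unitary \<open>W\<close> from one eigenbasis to the other intertwines the two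
  diagonal matrices. Entrywise, either \<open>W $$ (i, j) = 0\<close> or \<open>d i = d' j\<close>,
  so \<open>W\<close> intertwines the diagonal matrices of \<open>f\<close> as well. This makes the
  definite description in \<open>herm_fun\<close> well defined.\<close>

lemma spectral_fun_unique:
  assumes "spectral n A U d" "spectral n A V d'"
  shows "U * mat_diag n (\<lambda>i. complex_of_real (f (d i))) * mat_adjoint U =
    V * mat_diag n (\<lambda>i. complex_of_real (f (d' i))) * mat_adjoint V"
proof -
  have U: "unitary n U" and V: "unitary n V" using assms by (auto simp: spectral_def)
  note Ud = unitaryD[OF U] and Vd = unitaryD[OF V]
  let ?D = "\<lambda>g d. mat_diag n (\<lambda>i. complex_of_real (g (d i :: real) :: real))"
  note [simp] = mat_diag_dim[of n]
  define W where "W = mat_adjoint U * V"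
  have W: "W \<in> carrier_mat n n" using Ud Vd by (simp add: W_def)
  note assoc = assoc_mult_mat[of _ n n _ n _ n]
  have "?D (\<lambda>x. x) d * W = mat_adjoint U * A * V"
  proof -
    have "mat_adjoint U * A * V = (mat_adjoint U * U) * ?D (\<lambda>x. x) d * (mat_adjoint U * V)"
      using assms(1) Ud(1,2) Vd(1,2) unfolding spectral_def by (simp add: assoc)
    then show ?thesis using Ud Vd by (simp add: W_def)
  qed
  also have "\<dots> = W * ?D (\<lambda>x. x) d'"
  proof -
    have "mat_adjoint U * A * V = (mat_adjoint U * V) * ?D (\<lambda>x. x) d' * (mat_adjoint V * V)"
      using assms(2) Ud(1,2) Vd(1,2) unfolding spectral_def by (simp add: assoc)
    then show ?thesis using Ud Vd by (simp add: W_def)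
  qed
  finally have eq: "?D (\<lambda>x. x) d * W = W * ?D (\<lambda>x. x) d'" .
  have "?D f d * W = W * ?D f d'"
  proof (rule eq_matI)
    fix i j assume "i < dim_row (W * ?D f d')" "j < dim_col (W * ?D f d')"
    then have ij: "i < n" "j < n" using W by (auto simp: mat_diag_def)
    have "(?D (\<lambda>x. x) d * W) $$ (i, j) = (W * ?D (\<lambda>x. x) d') $$ (i, j)" using eq by simp
    then have "of_real (d i) * W $$ (i, j) = W $$ (i, j) * of_real (d' j)"
      using ij W by (simp add: mat_diag_mult_left[OF W] mat_diag_mult_right[OF W])
    then have "W $$ (i, j) = 0 \<or> d i = d' j" by auto
    then show "(?D f d * W) $$ (i, j) = (W * ?D f d') $$ (i, j)"
      using ij W by (auto simp: mat_diag_mult_left[OF W] mat_diag_mult_right[OF W])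
  qed (use W in \<open>auto simp: mat_diag_def\<close>)
  then have "U * (?D f d * W) * mat_adjoint V = U * (W * ?D f d') * mat_adjoint V" by simp
  moreover have "U * (?D f d * W) * mat_adjoint V = U * ?D f d * mat_adjoint U * (V * mat_adjoint V)"
    unfolding W_def using Ud(1,2) Vd(1,2) by (simp add: assoc)
  moreover have "U * (W * ?D f d') * mat_adjoint V = (U * mat_adjoint U) * V * ?D f d' * mat_adjoint V"
    unfolding W_def using Ud(1,2) Vd(1,2) by (simp add: assoc)
  ultimately show ?thesis using Ud Vd by simp
qed

lemma herm_fun_spectral:
  assumes "spectral n A U d"
  shows "herm_fun f A = U * mat_diag n (\<lambda>i. complex_of_real (f (d i))) * mat_adjoint U"
proof -
  have dim: "dim_row A = n" using spectral_carrier[OF assms] by auto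
  show ?thesis unfolding herm_fun_def dim
  proof (rule the_equality)
    show "\<exists>V d'. unitary n V \<and> A = V * mat_diag n (\<lambda>i. complex_of_real (d' i)) * mat_adjoint V \<and>
      U * mat_diag n (\<lambda>i. complex_of_real (f (d i))) * mat_adjoint U =
      V * mat_diag n (\<lambda>i. complex_of_real (f (d' i))) * mat_adjoint V"
      using assms unfolding spectral_def by blast
  next
    fix B assume "\<exists>V d'. unitary n V \<and> A = V * mat_diag n (\<lambda>i. complex_of_real (d' i)) * mat_adjoint V \<and>
      B = V * mat_diag n (\<lambda>i. complex_of_real (f (d' i))) * mat_adjoint V"
    then obtain V d' where "spectral n A V d'"
      "B = V * mat_diag n (\<lambda>i. complex_of_real (f (d' i))) * mat_adjoint V"
      unfolding spectral_def by blast
    then show "B = U * mat_diag n (\<lambda>i. complex_of_real (f (d i))) * mat_adjoint U"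
      using spectral_fun_unique[OF assms] by metis
  qed
qed

section \<open>Positive semidefinite matrices\<close>

lemma psd_conjugate:
  assumes "psd n A" "C \<in> carrier_mat n k"
  shows "psd k (mat_adjoint C * A * C)"
proof -
  have A: "A \<in> carrier_mat n n" "mat_adjoint A = A" using assms by (auto simp: psd_def)
  have "Re ((mat_adjoint C * A * C *\<^sub>v v) \<bullet>c v) \<ge> 0" if v: "v \<in> carrier_vec k" for v
  proof -
    have "mat_adjoint C * A * C *\<^sub>v v = mat_adjoint C *\<^sub>v (A *\<^sub>v (C *\<^sub>v v))"
      using A assms v by (simp add: assoc_mult_mat_vec[of _ k n _ n] assoc_mult_mat_vec[of _ k n _ k] assoc_mult_mat[of _ k n _ n _ k])
    then have "(mat_adjoint C * A * C *\<^sub>v v) \<bullet>c v = (A *\<^sub>v (C *\<^sub>v v)) \<bullet>c (C *\<^sub>v v)"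
      using A assms v by (simp add: cscalar_prod_adjoint[of _ k n])
    then show ?thesis using assms v by (auto simp: psd_def)
  qed
  then show ?thesis unfolding psd_def using A assms
    by (auto simp: mat_adjoint_mult[of _ k n _ k] mat_adjoint_mult[of _ n n _ k] mat_adjoint_mult[of _ k n _ n] assoc_mult_mat[of _ k n _ n _ k])
qed

lemma psd_diag_nonneg:
  assumes "psd n A" "i < n"
  shows "0 \<le> Re (A $$ (i, i))"
proof -
  have A: "A \<in> carrier_mat n n" using assms by (auto simp: psd_def)
  have "(A *\<^sub>v unit_vec n i) \<bullet>c unit_vec n i = A $$ (i, i)"
    using A assms(2) by (simp add: cscalar_prod_sum[of _ n] if_distrib[of cnj]
      if_distrib[of "(*) _"] unit_vec_def scalar_prod_def sum.delta cong: if_cong)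
  then show ?thesis using assms by (auto simp: psd_def dest: bspec[of _ _ "unit_vec n i"])
qed

lemma psd_trace_nonneg: "psd n A \<Longrightarrow> 0 \<le> Re (mat_trace A)"
  unfolding mat_trace_def using psd_diag_nonneg by (auto simp: psd_def intro!: sum_nonneg)

text \<open>Conjugating back by \<open>U\<close> shows that the diagonal matrix of eigenvalues is
  itself positive semidefinite, hence has nonnegative diagonal entries.\<close>

lemma psd_spectral:
  assumes "psd n A"
  obtains U d where "spectral n A U d" "\<And>i. i < n \<Longrightarrow> d i \<ge> 0"
proof -
  have A: "A \<in> carrier_mat n n" "mat_adjoint A = A" using assms by (auto simp: psd_def)
  obtain U d where U: "unitary n U" and d: "A = U * mat_diag n (\<lambda>i. complex_of_real (d i)) * mat_adjoint U"
    using hermitian_diagonalization[OF A] by blast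
  note Ud = unitaryD[OF U]
  let ?D = "mat_diag n (\<lambda>i. complex_of_real (d i))"
  have "mat_adjoint U * A * U = (mat_adjoint U * U) * ?D * (mat_adjoint U * U)"
    unfolding d using Ud(1,2) mat_diag_dim[of n "\<lambda>i. complex_of_real (d i)"]
    by (simp add: assoc_mult_mat[of _ n n _ n _ n])
  then have "mat_adjoint U * A * U = ?D" using Ud mat_diag_dim[of n "\<lambda>i. complex_of_real (d i)"] by simp
  then have "psd n ?D" using psd_conjugate[OF assms Ud(1)] by simp
  then have "d i \<ge> 0" if "i < n" for i using psd_diag_nonneg[of n ?D i] that by (simp add: mat_diag_def)
  then show ?thesis using that U d unfolding spectral_def by blast
qed

subsection \<open>Relative entropy in terms of eigenvalues\<close>

lemma spectral_kernel_iff: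
  assumes "spectral n A U d"
  shows "w \<in> mat_kernel A \<longleftrightarrow> w \<in> carrier_vec n \<and> (\<forall>i<n. d i \<noteq> 0 \<longrightarrow> (mat_adjoint U *\<^sub>v w) $ i = 0)"
proof -
  have U: "unitary n U" and A: "A = U * mat_diag n (\<lambda>i. complex_of_real (d i)) * mat_adjoint U"
    using assms by (auto simp: spectral_def)
  note Ud = unitaryD[OF U] and Ac = spectral_carrier[OF assms]
  let ?D = "mat_diag n (\<lambda>i. complex_of_real (d i))"
  have "A *\<^sub>v w = 0\<^sub>v n \<longleftrightarrow> (\<forall>i<n. d i \<noteq> 0 \<longrightarrow> (mat_adjoint U *\<^sub>v w) $ i = 0)" if w: "w \<in> carrier_vec n"
  proof -
    let ?u = "mat_adjoint U *\<^sub>v w"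
    have u: "?u \<in> carrier_vec n" using Ud by simp
    have Aw: "A *\<^sub>v w = U *\<^sub>v (?D *\<^sub>v ?u)" unfolding A
      using Ud(1,2) w mat_diag_dim[of n] by (simp add: assoc_mult_mat_vec[of _ n n _ n] assoc_mult_mat[of _ n n _ n _ n])
    have "mat_adjoint U *\<^sub>v (A *\<^sub>v w) = (mat_adjoint U * U) *\<^sub>v (?D *\<^sub>v ?u)" unfolding Aw
      using Ud(1,2) by (intro assoc_mult_mat_vec[symmetric]) auto
    then have UAw: "mat_adjoint U *\<^sub>v (A *\<^sub>v w) = ?D *\<^sub>v ?u" using Ud(3) by simp
    have "A *\<^sub>v w = 0\<^sub>v n \<longleftrightarrow> ?D *\<^sub>v ?u = 0\<^sub>v n"
    proof
      assume "A *\<^sub>v w = 0\<^sub>v n" then show "?D *\<^sub>v ?u = 0\<^sub>v n"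
        unfolding UAw[symmetric] using Ud(2) by (auto intro!: eq_vecI)
    next
      assume "?D *\<^sub>v ?u = 0\<^sub>v n" then show "A *\<^sub>v w = 0\<^sub>v n"
        unfolding Aw using Ud(1) by (auto intro!: eq_vecI)
    qed
    also have "\<dots> \<longleftrightarrow> (\<forall>i<n. of_real (d i) * ?u $ i = 0)"
    proof -
      have "(?D *\<^sub>v ?u) $ i = of_real (d i) * ?u $ i" if "i < n" for i
        using that u by (subst index_mult_mat_vec_sum[of _ n n])
          (auto simp: mat_diag_def if_distrib[of "\<lambda>x. x * _"] sum.delta cong: if_cong simp del: index_mult_mat_vec)
      then show ?thesis by (auto simp: vec_eq_iff simp del: index_mult_mat_vec)
    qed
    finally show ?thesis by auto
  qed
  then show ?thesis using mat_kernel[OF Ac] by auto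
qed

lemma mult_unit_vec:
  fixes A :: "complex mat"
  assumes "A \<in> carrier_mat n m" "j < m" "i < n"
  shows "(A *\<^sub>v unit_vec m j) $ i = A $$ (i, j)"
  using assms by (subst index_mult_mat_vec_sum[of _ n m])
    (auto simp: unit_vec_def if_distrib[of "(*) _"] sum.delta cong: if_cong simp del: index_mult_mat_vec)

lemma unitary_mult_adjoint_vec:
  assumes "unitary n U" "v \<in> carrier_vec n"
  shows "U *\<^sub>v (mat_adjoint U *\<^sub>v v) = v" "mat_adjoint U *\<^sub>v (U *\<^sub>v v) = v"
  using unitaryD[OF assms(1)] assms(2)
  by (simp_all flip: assoc_mult_mat_vec[of _ n n _ n])

text \<open>In eigenvector coordinates the kernel is a coordinate subspace. As
  \<open>mat_adjoint U\<close> preserves inner products, the support is the complementary coordinate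
  subspace.\<close>

lemma spectral_supp_iff:
  assumes "spectral n A U d"
  shows "v \<in> mat_supp A \<longleftrightarrow> v \<in> carrier_vec n \<and> (\<forall>i<n. d i = 0 \<longrightarrow> (mat_adjoint U *\<^sub>v v) $ i = 0)"
proof -
  have U: "unitary n U" using assms by (auto simp: spectral_def)
  note Ud = unitaryD[OF U] and Ac = spectral_carrier[OF assms]
  have ip: "v \<bullet>c w = (\<Sum>i<n. (mat_adjoint U *\<^sub>v v) $ i * cnj ((mat_adjoint U *\<^sub>v w) $ i))"
    if "v \<in> carrier_vec n" "w \<in> carrier_vec n" for v w
  proof -
    have "v \<bullet>c w = v \<bullet>c (U *\<^sub>v (mat_adjoint U *\<^sub>v w))" using unitary_mult_adjoint_vec[OF U that(2)] by simp
    also have "\<dots> = (mat_adjoint U *\<^sub>v v) \<bullet>c (mat_adjoint U *\<^sub>v w)"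
      using cscalar_prod_adjoint[of "mat_adjoint U" n n v "mat_adjoint U *\<^sub>v w"] that Ud by simp
    finally show ?thesis using Ud by (subst (asm) cscalar_prod_sum[of _ n]) auto
  qed
  show ?thesis
  proof (intro iffI conjI allI impI)
    assume v: "v \<in> mat_supp A"
    show vc: "v \<in> carrier_vec n" using v Ac by (auto simp: mat_supp_def)
    fix i assume i: "i < n" "d i = 0"
    \<comment> \<open>This eigenvector for the eigenvalue 0 lies in the kernel, and its inner
      product with \<open>v\<close> is the coordinate in question.\<close>
    let ?w = "U *\<^sub>v unit_vec n i"
    have Uw: "mat_adjoint U *\<^sub>v ?w = unit_vec n i" by (rule unitary_mult_adjoint_vec[OF U]) simp
    have "?w \<in> mat_kernel A" unfolding spectral_kernel_iff[OF assms] Uw using Ud i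
      by (auto simp: unit_vec_def)
    then have "v \<bullet>c ?w = 0" using v by (auto simp: mat_supp_def)
    then show "(mat_adjoint U *\<^sub>v v) $ i = 0" using ip[OF vc, of ?w] Ud i unfolding Uw
      by (simp add: unit_vec_def if_distrib[of cnj] if_distrib[of "(*) _"] sum.delta cong: if_cong del: index_mult_mat_vec)
  next
    assume v: "v \<in> carrier_vec n \<and> (\<forall>i<n. d i = 0 \<longrightarrow> (mat_adjoint U *\<^sub>v v) $ i = 0)"
    have "v \<bullet>c w = 0" if "w \<in> mat_kernel A" for w
    proof -
      have w: "w \<in> carrier_vec n" "\<And>i. i < n \<Longrightarrow> d i \<noteq> 0 \<Longrightarrow> (mat_adjoint U *\<^sub>v w) $ i = 0"
        using that unfolding spectral_kernel_iff[OF assms] by auto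
      show ?thesis unfolding ip[OF conjunct1[OF v] w(1)]
      proof (intro sum.neutral ballI)
        fix i assume "i \<in> {..<n}"
        then show "(mat_adjoint U *\<^sub>v v) $ i * cnj ((mat_adjoint U *\<^sub>v w) $ i) = 0"
          using v w(2)[of i] by (cases "d i = 0") (auto simp del: index_mult_mat_vec)
      qed
    qed
    then show "v \<in> mat_supp A" using v Ac by (auto simp: mat_supp_def)
  qed
qed

text \<open>The squared modulus of the inner product of the eigenvectors \<open>col U i\<close> and
  \<open>col V j\<close>. Weighted by \<open>overlap\<close>, relative entropy becomes a classical
  double sum over eigenvalues.\<close>

definition overlap :: "complex mat \<Rightarrow> complex mat \<Rightarrow> nat \<Rightarrow> nat \<Rightarrow> real" where
  "overlap U V i j = (cmod ((mat_adjoint U * V) $$ (i, j)))\<^sup>2"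

text \<open>The support of \<sigma> is spanned by its eigenvectors with
  \<open>q j \<noteq> 0\<close>; each must be orthogonal to all eigenvectors of \<rho> with
  \<open>p i = 0\<close>.\<close>

lemma mat_supp_subset_iff:
  assumes \<rho>: "spectral n \<rho> U p" and \<sigma>: "spectral n \<sigma> V q"
  shows "mat_supp \<sigma> \<subseteq> mat_supp \<rho> \<longleftrightarrow>
    (\<forall>i<n. \<forall>j<n. p i = 0 \<longrightarrow> q j \<noteq> 0 \<longrightarrow> overlap U V i j = 0)"
proof -
  have U: "unitary n U" and V: "unitary n V" using assms by (auto simp: spectral_def)
  note Ud = unitaryD[OF U] and Vd = unitaryD[OF V]
  let ?W = "mat_adjoint U * V"
  have W: "?W \<in> carrier_mat n n" using Ud Vd by simp
  have z: "overlap U V i j = 0 \<longleftrightarrow> ?W $$ (i, j) = 0" for i j by (simp add: overlap_def del: index_mult_mat(1))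
  show ?thesis unfolding z
  proof (intro iffI allI impI subsetI)
    fix i j assume sub: "mat_supp \<sigma> \<subseteq> mat_supp \<rho>" and ij: "i < n" "j < n" "p i = 0" "q j \<noteq> 0"
    let ?v = "V *\<^sub>v unit_vec n j"
    have "mat_adjoint V *\<^sub>v ?v = unit_vec n j" by (rule unitary_mult_adjoint_vec[OF V]) simp
    then have "?v \<in> mat_supp \<sigma>" unfolding spectral_supp_iff[OF \<sigma>] using Vd ij by (auto simp: unit_vec_def)
    then have "(mat_adjoint U *\<^sub>v ?v) $ i = 0" using sub spectral_supp_iff[OF \<rho>] ij by blast
    moreover have "mat_adjoint U *\<^sub>v ?v = ?W *\<^sub>v unit_vec n j"
      using Ud(1,2) Vd(1) by (simp add: assoc_mult_mat_vec[of _ n n _ n])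
    ultimately show "?W $$ (i, j) = 0" using mult_unit_vec[OF W ij(2,1)] by simp
  next
    fix v assume W0: "\<forall>i<n. \<forall>j<n. p i = 0 \<longrightarrow> q j \<noteq> 0 \<longrightarrow> ?W $$ (i, j) = 0" and v: "v \<in> mat_supp \<sigma>"
    from v have vc: "v \<in> carrier_vec n" and v0: "\<And>j. j < n \<Longrightarrow> q j = 0 \<Longrightarrow> (mat_adjoint V *\<^sub>v v) $ j = 0"
      unfolding spectral_supp_iff[OF \<sigma>] by auto
    have e: "mat_adjoint U *\<^sub>v v = ?W *\<^sub>v (mat_adjoint V *\<^sub>v v)"
      using Ud(1,2) Vd(1,2) vc unitary_mult_adjoint_vec[OF V vc] by (simp add: assoc_mult_mat_vec[of _ n n _ n])
    have "(mat_adjoint U *\<^sub>v v) $ i = 0" if i: "i < n" "p i = 0" for i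
    proof -
      have "(mat_adjoint U *\<^sub>v v) $ i = (\<Sum>j<n. ?W $$ (i, j) * (mat_adjoint V *\<^sub>v v) $ j)"
        unfolding e using W i Vd(2) by (intro index_mult_mat_vec_sum) auto
      also have "\<dots> = 0"
      proof (intro sum.neutral ballI)
        fix j assume "j \<in> {..<n}"
        then show "?W $$ (i, j) * (mat_adjoint V *\<^sub>v v) $ j = 0"
          using v0[of j] W0 i by (cases "q j = 0") (auto simp del: index_mult_mat_vec index_mult_mat(1))
      qed
      finally show ?thesis .
    qed
    then show "v \<in> mat_supp \<rho>" unfolding spectral_supp_iff[OF \<rho>] using vc by blast
  qed
qed

text \<open>Operators are expanded as \<open>U * x * mat_adjoint V\<close> in a mixed basis, with
  rows indexed by eigenvectors of one operator and columns by those of the other. Left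
  multiplication by the first and right multiplication by the second are then both diagonal.\<close>

lemma trace_spectral_mult:
  assumes A: "spectral n A V q" and X: "x \<in> carrier_mat n n" and U: "unitary n U"
  shows "mat_trace (A * (U * x * mat_adjoint V)) =
    (\<Sum>i<n. \<Sum>j<n. of_real (q j) * cnj ((mat_adjoint U * V) $$ (i, j)) * x $$ (i, j))"
proof -
  have V: "unitary n V" and Ae: "A = V * mat_diag n (\<lambda>i. complex_of_real (q i)) * mat_adjoint V"
    using A by (auto simp: spectral_def)
  note Ud = unitaryD[OF U] and Vd = unitaryD[OF V]
  let ?Q = "mat_diag n (\<lambda>i. complex_of_real (q i))" and ?W = "mat_adjoint U * V"
  have W: "?W \<in> carrier_mat n n" using Ud Vd by simp
  have WQ: "?Q * mat_adjoint ?W \<in> carrier_mat n n" using Ud by simp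
  have adjW: "mat_adjoint ?W = mat_adjoint V * U" using Ud Vd by (simp add: mat_adjoint_mult[of _ n n _ n])
  have "A * (U * x * mat_adjoint V) = V * ((?Q * mat_adjoint ?W * x) * mat_adjoint V)"
    unfolding Ae adjW using Ud(1,2) Vd(1,2) X mat_diag_dim[of n "\<lambda>i. complex_of_real (q i)"]
    by (simp add: assoc_mult_mat[of _ n n _ n _ n])
  then have "mat_trace (A * (U * x * mat_adjoint V)) = mat_trace (((?Q * mat_adjoint ?W * x) * mat_adjoint V) * V)"
    using Vd X Ud by (simp add: mat_trace_comm[of V n n])
  also have "((?Q * mat_adjoint ?W * x) * mat_adjoint V) * V = ?Q * mat_adjoint ?W * x"
    using Vd X Ud WQ by (simp add: assoc_mult_mat[of "?Q * mat_adjoint ?W * x" n n "mat_adjoint V" n V n])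
  also have "mat_trace \<dots> = (\<Sum>j<n. \<Sum>i<n. (?Q * mat_adjoint ?W) $$ (j, i) * x $$ (i, j))"
    by (rule mat_trace_mult[OF WQ X])
  also have "\<dots> = (\<Sum>j<n. \<Sum>i<n. of_real (q j) * cnj (?W $$ (i, j)) * x $$ (i, j))"
    using W Ud Vd by (intro sum.cong refl) (simp add: mat_diag_mult_left[of _ n n] del: index_mult_mat(1))
  finally show ?thesis by (subst sum.swap)
qed

lemma trace_spectral_herm_fun:
  assumes A: "spectral n A V q" and B: "spectral n B U p"
  shows "mat_trace (A * herm_fun f B) = of_real (\<Sum>i<n. \<Sum>j<n. overlap U V i j * q j * f (p i))"
proof -
  have U: "unitary n U" and V: "unitary n V" using A B by (auto simp: spectral_def)
  note Ud = unitaryD[OF U] and Vd = unitaryD[OF V]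
  let ?F = "mat_diag n (\<lambda>i. complex_of_real (f (p i)))" and ?W = "mat_adjoint U * V"
  have W: "?W \<in> carrier_mat n n" using Ud Vd by simp
  have FW: "?F * ?W \<in> carrier_mat n n" using Vd by simp
  \<comment> \<open>Inserting \<open>V * mat_adjoint V\<close> on the right brings the functional
    calculus of \<open>B\<close> into the mixed basis.\<close>
  have "herm_fun f B = U * (?F * ?W) * mat_adjoint V"
  proof -
    have "U * (?F * ?W) * mat_adjoint V = U * ?F * mat_adjoint U * (V * mat_adjoint V)"
      using Ud(1,2) Vd(1,2) mat_diag_dim[of n "\<lambda>i. complex_of_real (f (p i))"]
      by (simp add: assoc_mult_mat[of _ n n _ n _ n])
    then show ?thesis using Vd Ud by (simp add: herm_fun_spectral[OF B])
  qed
  then have "mat_trace (A * herm_fun f B) =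
    (\<Sum>i<n. \<Sum>j<n. of_real (q j) * cnj (?W $$ (i, j)) * (?F * ?W) $$ (i, j))"
    using trace_spectral_mult[OF A FW U] by simp
  also have "\<dots> = (\<Sum>i<n. \<Sum>j<n. of_real (overlap U V i j * q j * f (p i)))"
    using W by (intro sum.cong refl) (simp add: overlap_def mat_diag_mult_left[OF W] complex_norm_square
      mult_ac del: index_mult_mat(1) of_real_power)
  finally show ?thesis by simp
qed

definition ln0 :: "real \<Rightarrow> real" where
  "ln0 x = (if x > 0 then ln x else 0)"

lemma mat_log_eq: "mat_log = herm_fun ln0"
  unfolding mat_log_def ln0_def[abs_def] ..

lemma herm_fun_carrier:
  assumes "spectral n A U d"
  shows "herm_fun f A \<in> carrier_mat n n"
  using assms unitaryD[of n U] by (simp add: herm_fun_spectral[OF assms]) (simp add: spectral_def)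

lemma overlap_self:
  assumes "unitary n V" "i < n" "j < n"
  shows "overlap V V i j = (if i = j then 1 else 0)"
  using unitaryD(3)[OF assms(1)] assms(2,3) by (simp add: overlap_def)

text \<open>The first argument \<sigma> has eigenvalues \<open>q\<close>, the second argument \<rho>
  has eigenvalues \<open>p\<close>. The overlaps of \<sigma> with itself form the identity matrix,
  which collapses the first trace to a single sum.\<close>

lemma rel_entropy_spectral:
  assumes \<rho>: "spectral n \<rho> U p" and \<sigma>: "spectral n \<sigma> V q"
  shows "rel_entropy \<sigma> \<rho> = (if \<forall>i<n. \<forall>j<n. p i = 0 \<longrightarrow> q j \<noteq> 0 \<longrightarrow> overlap U V i j = 0
    then ereal ((\<Sum>j<n. q j * ln0 (q j)) - (\<Sum>i<n. \<Sum>j<n. overlap U V i j * q j * ln0 (p i))) else \<infinity>)"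
proof -
  have V: "unitary n V" using \<sigma> by (auto simp: spectral_def)
  note c = spectral_carrier[OF \<sigma>] herm_fun_carrier[OF \<sigma>, of ln0] herm_fun_carrier[OF \<rho>, of ln0]
  have "mat_trace (\<sigma> * (mat_log \<sigma> - mat_log \<rho>)) =
      mat_trace (\<sigma> * herm_fun ln0 \<sigma>) - mat_trace (\<sigma> * herm_fun ln0 \<rho>)"
    unfolding mat_log_eq using c by (simp add: mult_minus_distrib_mat[of _ n n _ n] mat_trace_minus[of _ n])
  moreover have "(\<Sum>i<n. \<Sum>j<n. overlap V V i j * q j * ln0 (q i)) = (\<Sum>j<n. q j * ln0 (q j))"
    by (intro sum.cong refl) (simp add: overlap_self[OF V] if_distrib[of "\<lambda>x. x * _"] sum.delta cong: if_cong)
  ultimately show ?thesis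
    unfolding rel_entropy_def mat_supp_subset_iff[OF \<rho> \<sigma>]
    by (simp add: trace_spectral_herm_fun[OF \<sigma> \<rho>] trace_spectral_herm_fun[OF \<sigma> \<sigma>]) blast
qed

subsection \<open>A variational form of the resolvent of the relative modular operator\<close>

text \<open>With L left multiplication by \<rho> and R right multiplication by \<sigma>, this is
  twice the real part of the Hilbert--Schmidt product of \<sigma> and \<open>X\<close>, minus the
  quadratic form of L + t R at \<open>X\<close>.\<close>

definition var_form :: "real \<Rightarrow> complex mat \<Rightarrow> complex mat \<Rightarrow> complex mat \<Rightarrow> real" where
  "var_form t \<rho> \<sigma> X = 2 * Re (mat_trace (\<sigma> * X)) - Re (mat_trace (\<rho> * (X * mat_adjoint X)))
     - t * Re (mat_trace (\<sigma> * (mat_adjoint X * X)))"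

text \<open>For \<open>w\<close> the overlaps of \<rho> and \<sigma> this is the quadratic form of
  the inverse of L + t R at \<sigma>, since L + t R is diagonal in the mixed basis with entries
  \<open>p i + t * q j\<close>. A vanishing denominator contributes 0.\<close>

definition resolvent :: "nat \<Rightarrow> (nat \<Rightarrow> nat \<Rightarrow> real) \<Rightarrow> (nat \<Rightarrow> real) \<Rightarrow> (nat \<Rightarrow> real) \<Rightarrow> real \<Rightarrow> real" where
  "resolvent n w p q t = (\<Sum>i<n. \<Sum>j<n. w i j * (q j)\<^sup>2 / (p i + t * q j))"

lemma trace_spectral_square:
  assumes A: "spectral n A U p" and x: "x \<in> carrier_mat n n" and V: "unitary n V"
  shows "Re (mat_trace (A * ((U * x * mat_adjoint V) * mat_adjoint (U * x * mat_adjoint V)))) =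
    (\<Sum>i<n. \<Sum>j<n. p i * (cmod (x $$ (i, j)))\<^sup>2)"
proof -
  have U: "unitary n U" and Ae: "A = U * mat_diag n (\<lambda>i. complex_of_real (p i)) * mat_adjoint U"
    using A by (auto simp: spectral_def)
  note Ud = unitaryD[OF U] and Vd = unitaryD[OF V]
  note Ac = spectral_carrier[OF A]
  let ?P = "mat_diag n (\<lambda>i. complex_of_real (p i))"
  have "(U * x * mat_adjoint V) * mat_adjoint (U * x * mat_adjoint V)
      = U * x * (mat_adjoint V * V) * mat_adjoint x * mat_adjoint U"
    using Ud(1,2) Vd(1,2) x by (simp add: mat_adjoint_mult[of _ n n _ n] assoc_mult_mat[of _ n n _ n _ n])
  also have "\<dots> = U * (x * mat_adjoint x) * mat_adjoint U"
    using Ud(1,2) Vd x by (simp add: assoc_mult_mat[of _ n n _ n _ n])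
  finally have "mat_trace (A * ((U * x * mat_adjoint V) * mat_adjoint (U * x * mat_adjoint V))) =
    (\<Sum>i<n. \<Sum>j<n. of_real (p j) * cnj ((mat_adjoint U * U) $$ (i, j)) * (x * mat_adjoint x) $$ (i, j))"
    using trace_spectral_mult[OF A _ U, of "x * mat_adjoint x"] x by simp
  also have "\<dots> = (\<Sum>i<n. of_real (p i) * (x * mat_adjoint x) $$ (i, i))"
    unfolding Ud(3) by (intro sum.cong refl)
      (simp add: if_distrib[of "\<lambda>x. x * _"] if_distrib[of cnj] if_distrib[of "(*) _"] sum.delta
        cong: if_cong del: index_mult_mat(1))
  also have "\<dots> = (\<Sum>i<n. of_real (p i) * (\<Sum>j<n. of_real ((cmod (x $$ (i, j)))\<^sup>2)))"
    using x by (intro sum.cong refl arg_cong2[of _ _ _ _ "(*)"], subst index_mult_mat_sum[of _ n n _ n])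
      (auto simp: complex_norm_square simp del: of_real_power)
  finally show ?thesis by (simp add: sum_distrib_left)
qed

text \<open>The mixed basis decouples the form into one scalar quadratic function for each entry of
  \<open>x\<close>.\<close>

lemma var_form_spectral:
  assumes \<rho>: "spectral n \<rho> U p" and \<sigma>: "spectral n \<sigma> V q" and x: "x \<in> carrier_mat n n"
  shows "var_form t \<rho> \<sigma> (U * x * mat_adjoint V) =
    (\<Sum>i<n. \<Sum>j<n. 2 * q j * Re (cnj ((mat_adjoint U * V) $$ (i, j)) * x $$ (i, j))
       - (p i + t * q j) * (cmod (x $$ (i, j)))\<^sup>2)"
proof -
  have U: "unitary n U" and V: "unitary n V" using assms by (auto simp: spectral_def)
  note Ud = unitaryD[OF U] and Vd = unitaryD[OF V]
  let ?X = "U * x * mat_adjoint V"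
  have adj: "mat_adjoint ?X = V * mat_adjoint x * mat_adjoint U"
    using Ud(1,2) Vd(1,2) x by (simp add: mat_adjoint_mult[of _ n n _ n] assoc_mult_mat[of _ n n _ n _ n])
  have 1: "Re (mat_trace (\<sigma> * ?X)) =
    (\<Sum>i<n. \<Sum>j<n. q j * Re (cnj ((mat_adjoint U * V) $$ (i, j)) * x $$ (i, j)))"
    unfolding trace_spectral_mult[OF \<sigma> x U] by (simp add: mult.assoc del: index_mult_mat(1))
  have 2: "Re (mat_trace (\<rho> * (?X * mat_adjoint ?X))) = (\<Sum>i<n. \<Sum>j<n. p i * (cmod (x $$ (i, j)))\<^sup>2)"
    by (rule trace_spectral_square[OF \<rho> x V])
  \<comment> \<open>The adjoint of \<open>?X\<close> has the same shape with \<open>U\<close> and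
    \<open>V\<close> exchanged, so the formula for the square applies with \<sigma> in place of
    \<rho>.\<close>
  have "Re (mat_trace (\<sigma> * (mat_adjoint ?X * ?X))) = (\<Sum>i<n. \<Sum>j<n. q i * (cmod (mat_adjoint x $$ (i, j)))\<^sup>2)"
    using trace_spectral_square[OF \<sigma> _ U, of "mat_adjoint x"] x unfolding adj[symmetric] by simp
  also have "\<dots> = (\<Sum>i<n. \<Sum>j<n. q j * (cmod (x $$ (i, j)))\<^sup>2)"
    using x by (subst sum.swap) (intro sum.cong refl, auto)
  finally have 3: "Re (mat_trace (\<sigma> * (mat_adjoint ?X * ?X))) = (\<Sum>i<n. \<Sum>j<n. q j * (cmod (x $$ (i, j)))\<^sup>2)" .
  show ?thesis unfolding var_form_def 1 2 3
    by (simp add: sum_distrib_left sum_subtractf sum.distrib algebra_simps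
        del: index_mult_mat(1) times_complex.sel complex_cnj)
qed

text \<open>Every \<open>X\<close> has mixed coordinates \<open>x\<close>, and completing the square
  in each entry bounds its contribution by the corresponding term of the resolvent.\<close>

lemma var_form_le_resolvent:
  assumes \<rho>: "spectral n \<rho> U p" and \<sigma>: "spectral n \<sigma> V q"
    and p: "\<And>i. i < n \<Longrightarrow> p i \<ge> 0" and q: "\<And>i. i < n \<Longrightarrow> q i \<ge> 0" and t: "t > 0"
    and X: "X \<in> carrier_mat n n"
  shows "var_form t \<rho> \<sigma> X \<le> resolvent n (overlap U V) p q t"
proof -
  have U: "unitary n U" and V: "unitary n V" using assms by (auto simp: spectral_def)
  note Ud = unitaryD[OF U] and Vd = unitaryD[OF V]
  define x where "x = mat_adjoint U * X * V"
  have x: "x \<in> carrier_mat n n" using Ud Vd by (simp add: x_def)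
  have "U * x * mat_adjoint V = (U * mat_adjoint U) * X * (V * mat_adjoint V)"
    unfolding x_def using Ud(1,2) Vd(1,2) X by (simp add: assoc_mult_mat[of _ n n _ n _ n])
  then have X': "X = U * x * mat_adjoint V" using Ud Vd X by simp
  show ?thesis unfolding X' var_form_spectral[OF \<rho> \<sigma> x] resolvent_def
  proof (intro sum_mono)
    fix i j assume "i \<in> {..<n}" "j \<in> {..<n}"
    then have pq: "p i \<ge> 0" "q j \<ge> 0" using p q by auto
    let ?s = "p i + t * q j" and ?w = "(mat_adjoint U * V) $$ (i, j)" and ?x = "x $$ (i, j)"
    have s: "?s \<ge> 0" using pq t by simp
    show "2 * q j * Re (cnj ?w * ?x) - ?s * (cmod ?x)\<^sup>2 \<le> overlap U V i j * (q j)\<^sup>2 / ?s"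
    proof (cases "?s = 0")
      \<comment> \<open>If \<open>p i + t * q j = 0\<close> then \<open>q j = 0\<close>, so both
        sides are 0 because division by 0 gives 0.\<close>
      case True
      then have "q j = 0" using pq t by (metis add_nonneg_eq_0_iff less_imp_le mult_eq_0_iff mult_nonneg_nonneg order_less_irrefl)
      then show ?thesis using True by simp
    next
      case False
      then have s: "?s > 0" using s by simp
      have re: "Re (cnj ?w * ?x) \<le> cmod ?w * cmod ?x"
        by (metis complex_Re_le_cmod complex_mod_cnj norm_mult)
      have "2 * q j * Re (cnj ?w * ?x) \<le> 2 * q j * (cmod ?w * cmod ?x)"
        using re pq by (intro mult_left_mono) auto
      moreover have "0 \<le> (q j * cmod ?w - ?s * cmod ?x)\<^sup>2 / ?s" using s by simp
      moreover have "(q j * cmod ?w - ?s * cmod ?x)\<^sup>2 / ?s =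
        (cmod ?w)\<^sup>2 * (q j)\<^sup>2 / ?s - 2 * q j * (cmod ?w * cmod ?x) + ?s * (cmod ?x)\<^sup>2"
      proof -
        have "(a * c - s * b)\<^sup>2 / s = c\<^sup>2 * a\<^sup>2 / s - 2 * a * (c * b) + s * b\<^sup>2" if "s > 0" for a b c s :: real
          using that by (simp add: power2_eq_square field_simps)
        then show ?thesis using s by blast
      qed
      ultimately show ?thesis unfolding overlap_def by linarith
    qed
  qed
qed

lemma var_form_attains_resolvent:
  assumes \<rho>: "spectral n \<rho> U p" and \<sigma>: "spectral n \<sigma> V q"
  obtains X where "X \<in> carrier_mat n n" "var_form t \<rho> \<sigma> X = resolvent n (overlap U V) p q t"
proof -
  have U: "unitary n U" and V: "unitary n V" using assms by (auto simp: spectral_def)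
  note Ud = unitaryD[OF U] and Vd = unitaryD[OF V]
  let ?W = "mat_adjoint U * V"
  \<comment> \<open>The critical point of each scalar quadratic function, that is, the inverse of L
    + t R applied to \<sigma>.\<close>
  define x where "x = mat n n (\<lambda>(i, j). of_real (q j / (p i + t * q j)) * ?W $$ (i, j))"
  have x: "x \<in> carrier_mat n n" by (simp add: x_def)
  have "var_form t \<rho> \<sigma> (U * x * mat_adjoint V) = resolvent n (overlap U V) p q t"
    unfolding var_form_spectral[OF \<rho> \<sigma> x] resolvent_def
  proof (intro sum.cong refl)
    fix i j assume ij: "i \<in> {..<n}" "j \<in> {..<n}"
    let ?s = "p i + t * q j" and ?w = "?W $$ (i, j)"
    have xe: "x $$ (i, j) = of_real (q j / ?s) * ?w" using ij by (simp add: x_def del: index_mult_mat(1))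
    have a: "cnj ?w * x $$ (i, j) = of_real (q j / ?s * (cmod ?w)\<^sup>2)"
      unfolding xe by (simp add: complex_norm_square mult_ac del: index_mult_mat(1) of_real_power)
    have b: "(cmod (x $$ (i, j)))\<^sup>2 = (q j / ?s)\<^sup>2 * (cmod ?w)\<^sup>2"
      unfolding xe by (simp add: norm_mult norm_divide power_mult_distrib power_divide del: index_mult_mat(1) flip: of_real_add of_real_mult)
    \<comment> \<open>The case \<open>s = 0\<close> is consistent: with \<open>a / 0 = 0\<close>
      both sides vanish.\<close>
    have gen: "2 * a * (a / s * c) - s * ((a / s)\<^sup>2 * c) = c * a\<^sup>2 / s" for a s c :: real
      by (cases "s = 0") (simp_all add: power2_eq_square field_simps)
    show "2 * q j * Re (cnj ?w * x $$ (i, j)) - ?s * (cmod (x $$ (i, j)))\<^sup>2 = overlap U V i j * (q j)\<^sup>2 / ?s"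
      unfolding a b overlap_def Re_complex_of_real
      by (rule gen)
  qed
  moreover have "U * x * mat_adjoint V \<in> carrier_mat n n" using Ud Vd by simp
  ultimately show ?thesis using that by blast
qed

subsection \<open>Relative entropy from the resolvent\<close>

text \<open>The classical data left after diagonalising two states. Unit column sums of
  \<open>w\<close> and \<open>q_sum\<close> give the weights \<open>w i j * q j\<close> total mass
  1, which is the coefficient of \<open>ln t\<close> in \<open>interp\<close> at infinity.\<close>

locale overlap_data =
  fixes n :: nat and w :: "nat \<Rightarrow> nat \<Rightarrow> real" and p q :: "nat \<Rightarrow> real"
  assumes w_nonneg: "i < n \<Longrightarrow> j < n \<Longrightarrow> 0 \<le> w i j"
    and w_sum: "j < n \<Longrightarrow> (\<Sum>i<n. w i j) = 1"
    and p_nonneg: "i < n \<Longrightarrow> 0 \<le> p i"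
    and q_nonneg: "i < n \<Longrightarrow> 0 \<le> q i"
    and q_sum: "(\<Sum>j<n. q j) = 1"
begin

definition dominated :: bool where
  "dominated \<longleftrightarrow> (\<forall>i<n. \<forall>j<n. p i = 0 \<longrightarrow> q j \<noteq> 0 \<longrightarrow> w i j = 0)"

definition interp :: "real \<Rightarrow> real" where
  "interp t = (\<Sum>i<n. \<Sum>j<n. w i j * q j * ln (p i + t * q j))"

lemma interp_derivative:
  assumes t: "0 < t"
  shows "(interp has_real_derivative resolvent n w p q t) (at t)"
  unfolding interp_def[abs_def] resolvent_def
proof (intro DERIV_sum)
  fix i j assume "i \<in> {..<n}" "j \<in> {..<n}"
  then have pq: "0 \<le> p i" "0 \<le> q j" using p_nonneg q_nonneg by auto
  show "((\<lambda>t. w i j * q j * ln (p i + t * q j)) has_real_derivative w i j * (q j)\<^sup>2 / (p i + t * q j)) (at t)"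
  proof (cases "q j = 0")
    case False
    then have "0 < p i + t * q j" using pq t by (simp add: add_nonneg_pos)
    then show ?thesis by (auto intro!: derivative_eq_intros simp: power2_eq_square)
  qed simp
qed

text \<open>Since the weights have total mass 1, \<open>ln t\<close> can be subtracted inside each
  logarithm, and \<open>ln (p i + t * q j) - ln t\<close> tends to \<open>ln (q j)\<close> when
  \<open>q j > 0\<close>. The limit no longer depends on \<open>i\<close>, which is then summed
  out.\<close>

lemma interp_at_top: "((\<lambda>t. interp t - ln t) \<longlongrightarrow> (\<Sum>j<n. q j * ln0 (q j))) at_top"
proof -
  have lim: "((\<lambda>t. w i j * q j * (ln (p i + t * q j) - ln t)) \<longlongrightarrow> w i j * q j * ln0 (q j)) at_top"
    if ij: "i < n" "j < n" for i j
  proof (cases "q j = 0")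
    case False
    then have q: "0 < q j" using q_nonneg[OF ij(2)] by simp
    have "((\<lambda>t. p i * inverse t + q j) \<longlongrightarrow> p i * 0 + q j) at_top"
      by (intro tendsto_intros tendsto_inverse_0_at_top filterlim_ident)
    then have "((\<lambda>t. ln (p i * inverse t + q j)) \<longlongrightarrow> ln (q j)) at_top"
      using q by (intro tendsto_ln) auto
    moreover have "\<forall>\<^sub>F t in at_top. ln (p i * inverse t + q j) = ln (p i + t * q j) - ln t"
      using eventually_gt_at_top[of 0]
    proof eventually_elim
      case (elim t)
      have "0 < p i + t * q j" using p_nonneg[OF ij(1)] q elim by (simp add: add_nonneg_pos)
      moreover have "p i * inverse t + q j = (p i + t * q j) / t" using elim by (simp add: field_simps)
      ultimately show ?case using elim by (simp add: ln_div)
    qed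
    ultimately have "((\<lambda>t. ln (p i + t * q j) - ln t) \<longlongrightarrow> ln (q j)) at_top"
      by (rule Lim_transform_eventually)
    then show ?thesis using q by (auto intro!: tendsto_intros simp: ln0_def)
  qed simp
  have col: "(\<Sum>i<n. \<Sum>j<n. w i j * q j * c j) = (\<Sum>j<n. q j * c j)" for c :: "nat \<Rightarrow> real"
  proof -
    have "(\<Sum>i<n. \<Sum>j<n. w i j * q j * c j) = (\<Sum>j<n. (\<Sum>i<n. w i j) * (q j * c j))"
      by (subst sum.swap) (simp add: sum_distrib_right mult.assoc)
    then show ?thesis using w_sum by simp
  qed
  have "interp t - ln t = (\<Sum>i<n. \<Sum>j<n. w i j * q j * (ln (p i + t * q j) - ln t))" for t
    using col[of "\<lambda>_. ln t"] q_sum by (simp add: interp_def right_diff_distrib sum_subtractf flip: sum_distrib_right)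
  then show ?thesis unfolding col[symmetric] using lim by (auto intro!: tendsto_sum)
qed

text \<open>Terms with \<open>p i = 0\<close> have weight 0 by domination; the others are continuous
  at 0.\<close>

lemma interp_at_0:
  assumes dominated
  shows "(interp \<longlongrightarrow> (\<Sum>i<n. \<Sum>j<n. w i j * q j * ln0 (p i))) (at_right 0)"
  unfolding interp_def[abs_def]
proof (intro tendsto_sum)
  fix i j assume ij: "i \<in> {..<n}" "j \<in> {..<n}"
  then have pq: "0 \<le> p i" "0 \<le> q j" using p_nonneg q_nonneg by auto
  show "((\<lambda>t. w i j * q j * ln (p i + t * q j)) \<longlongrightarrow> w i j * q j * ln0 (p i)) (at_right 0)"
  proof (cases "p i = 0")
    case True
    then have "w i j * q j = 0" using assms ij unfolding dominated_def by auto
    then show ?thesis by auto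
  next
    case False
    have "((\<lambda>t. p i + t * q j) \<longlongrightarrow> p i + 0 * q j) (at_right 0)" by (intro tendsto_intros)
    then have "((\<lambda>t. ln (p i + t * q j)) \<longlongrightarrow> ln (p i)) (at_right 0)"
      using False by (intro tendsto_ln) auto
    then show ?thesis using False pq by (auto intro!: tendsto_intros simp: ln0_def)
  qed
qed

text \<open>The bound is the value at \<open>t = 0\<close>: a positive \<open>t\<close> only
  enlarges the denominators, and domination removes the terms with \<open>p i = 0\<close>.\<close>

lemma resolvent_bounded:
  assumes dominated
  obtains C where "0 \<le> C" "\<And>t. 0 < t \<Longrightarrow> resolvent n w p q t \<le> C"
proof
  let ?C = "\<Sum>i<n. \<Sum>j<n. w i j * (q j)\<^sup>2 / p i"
  show "0 \<le> ?C" using w_nonneg p_nonneg by (auto intro!: sum_nonneg)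
  fix t :: real assume t: "0 < t"
  show "resolvent n w p q t \<le> ?C" unfolding resolvent_def
  proof (intro sum_mono)
    fix i j assume ij: "i \<in> {..<n}" "j \<in> {..<n}"
    then have pq: "0 \<le> p i" "0 \<le> q j" "0 \<le> w i j" using p_nonneg q_nonneg w_nonneg by auto
    show "w i j * (q j)\<^sup>2 / (p i + t * q j) \<le> w i j * (q j)\<^sup>2 / p i"
    proof (cases "p i = 0")
      case True
      then have "w i j * (q j)\<^sup>2 = 0" using assms ij unfolding dominated_def by auto
      then show ?thesis by auto
    next
      case False
      then show ?thesis using pq t by (intro divide_left_mono) (auto intro!: mult_pos_pos add_pos_nonneg)
    qed
  qed
qed

lemma resolvent_lower:
  assumes "i < n" "j < n" "p i = 0" "0 < t"
  shows "w i j * q j / t \<le> resolvent n w p q t"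
proof -
  have nn: "0 \<le> w i' j' * (q j')\<^sup>2 / (p i' + t * q j')" if "i' < n" "j' < n" for i' j'
    using that w_nonneg p_nonneg q_nonneg assms(4) by simp
  have "w i j * q j / t = w i j * (q j)\<^sup>2 / (p i + t * q j)"
    using assms by (cases "q j = 0") (auto simp: power2_eq_square)
  also have "\<dots> \<le> (\<Sum>j<n. w i j * (q j)\<^sup>2 / (p i + t * q j))"
    using assms(2) nn[OF assms(1)] by (intro member_le_sum) auto
  also have "\<dots> \<le> resolvent n w p q t" unfolding resolvent_def
    using assms nn by (intro member_le_sum[of i "{..<n}" "\<lambda>i. \<Sum>j<n. w i j * (q j)\<^sup>2 / (p i + t * q j)"])
      (auto intro!: sum_nonneg)
  finally show ?thesis .
qed

text \<open>A pair violating domination contributes a term of order \<open>1 / t\<close>, so the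
  resolvent is unbounded near 0. The chosen \<open>t\<close> makes this term equal to
  \<open>C + 1\<close>.\<close>

lemma dominated_if_resolvent_bounded:
  assumes "0 \<le> C" "\<And>t. 0 < t \<Longrightarrow> resolvent n w p q t \<le> C"
  shows dominated
  unfolding dominated_def
proof (intro allI impI, rule ccontr)
  fix i j assume ij: "i < n" "j < n" "p i = 0" "q j \<noteq> 0" "w i j \<noteq> 0"
  then have pos: "0 < w i j * q j" using w_nonneg[of i j] q_nonneg[of j] by simp
  define t where "t = w i j * q j / (C + 1)"
  have t: "0 < t" using pos assms(1) by (simp add: t_def)
  have "w i j * q j / t = C + 1" using ij assms(1) by (simp add: t_def)
  then show False using resolvent_lower[OF ij(1-3) t] assms(2)[OF t] by linarith
qed

end

text \<open>The derivative of the difference of the two interpolations is nonnegative, so its limit at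
  \<open>0\<close> is at most its limit at infinity; there the two \<open>ln t\<close> divergences cancel.\<close>

lemma resolvent_le_imp_entropy_le:
  assumes "overlap_data n w p q" "overlap_data n' w' p' q'"
    and le: "\<And>t. 0 < t \<Longrightarrow> resolvent n' w' p' q' t \<le> resolvent n w p q t"
    and dom: "overlap_data.dominated n w p q"
  shows "overlap_data.dominated n' w' p' q'"
    and "(\<Sum>j<n'. q' j * ln0 (q' j)) - (\<Sum>i<n'. \<Sum>j<n'. w' i j * q' j * ln0 (p' i))
      \<le> (\<Sum>j<n. q j * ln0 (q j)) - (\<Sum>i<n. \<Sum>j<n. w i j * q j * ln0 (p i))"
proof -
  interpret A: overlap_data n w p q by fact
  interpret B: overlap_data n' w' p' q' by fact
  \<comment> \<open>Domination is equivalent to boundedness of the resolvent, and boundedness passes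
    to the smaller resolvent. Thus finiteness of the relative entropy is inherited.\<close>
  obtain C where "0 \<le> C" "\<And>t. 0 < t \<Longrightarrow> resolvent n w p q t \<le> C" using A.resolvent_bounded[OF dom] by blast
  then show B: B.dominated using le by (intro B.dominated_if_resolvent_bounded[of C]) (auto intro: order_trans)
  define h where "h t = A.interp t - B.interp t" for t
  have mono: "h s \<le> h t" if "0 < s" "s \<le> t" for s t
  proof (rule DERIV_nonneg_imp_nondecreasing[OF that(2)])
    fix x assume "s \<le> x"
    then have x: "0 < x" using that by simp
    show "\<exists>y. (h has_real_derivative y) (at x) \<and> 0 \<le> y" unfolding h_def
      using DERIV_diff[OF A.interp_derivative[OF x] B.interp_derivative[OF x]] le[OF x] by auto
  qed
  have top: "(h \<longlongrightarrow> (\<Sum>j<n. q j * ln0 (q j)) - (\<Sum>j<n'. q' j * ln0 (q' j))) at_top"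
    using tendsto_diff[OF A.interp_at_top B.interp_at_top] unfolding h_def by simp
  have zero: "(h \<longlongrightarrow> (\<Sum>i<n. \<Sum>j<n. w i j * q j * ln0 (p i)) - (\<Sum>i<n'. \<Sum>j<n'. w' i j * q' j * ln0 (p' i))) (at_right 0)"
    unfolding h_def by (intro tendsto_diff A.interp_at_0 B.interp_at_0 dom B)
  have "h s \<le> (\<Sum>j<n. q j * ln0 (q j)) - (\<Sum>j<n'. q' j * ln0 (q' j))" if "0 < s" for s
    using top by (rule tendsto_lowerbound)
      (auto intro: eventually_mono[OF eventually_ge_at_top[of s]] mono[OF that])
  then have "(\<Sum>i<n. \<Sum>j<n. w i j * q j * ln0 (p i)) - (\<Sum>i<n'. \<Sum>j<n'. w' i j * q' j * ln0 (p' i))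
      \<le> (\<Sum>j<n. q j * ln0 (q j)) - (\<Sum>j<n'. q' j * ln0 (q' j))"
    by (intro tendsto_upperbound[OF zero]) (auto intro: eventually_mono[OF eventually_at_right_less])
  then show "(\<Sum>j<n'. q' j * ln0 (q' j)) - (\<Sum>i<n'. \<Sum>j<n'. w' i j * q' j * ln0 (p' i))
      \<le> (\<Sum>j<n. q j * ln0 (q j)) - (\<Sum>i<n. \<Sum>j<n. w i j * q j * ln0 (p i))" by linarith
qed

lemma spectral_trace:
  assumes "spectral n A U d"
  shows "mat_trace A = of_real (\<Sum>i<n. d i)"
proof -
  have U: "unitary n U" and A: "A = U * mat_diag n (\<lambda>i. complex_of_real (d i)) * mat_adjoint U"
    using assms by (auto simp: spectral_def)
  note Ud = unitaryD[OF U]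
  let ?D = "mat_diag n (\<lambda>i. complex_of_real (d i))"
  have "mat_trace A = mat_trace (mat_adjoint U * (U * ?D))"
    unfolding A using Ud by (intro mat_trace_comm[of _ n n]) auto
  also have "mat_adjoint U * (U * ?D) = ?D"
    using Ud mat_diag_dim[of n] by (simp flip: assoc_mult_mat[of _ n n _ n _ n])
  finally show ?thesis by (simp add: mat_trace_def mat_diag_def)
qed

lemma state_overlap_data:
  assumes "spectral n \<rho> U p" "spectral n \<sigma> V q" "\<And>i. i < n \<Longrightarrow> 0 \<le> p i" "\<And>i. i < n \<Longrightarrow> 0 \<le> q i"
    and "mat_trace \<sigma> = 1"
  shows "overlap_data n (overlap U V) p q"
proof
  have "unitary n (mat_adjoint U * V)"
    using assms by (auto simp: spectral_def intro!: unitary_mult unitary_adjoint)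
  then show "(\<Sum>i<n. overlap U V i j) = 1" if "j < n" for j
    using unitary_col_norm that unfolding overlap_def by blast
  show "(\<Sum>j<n. q j) = 1" using spectral_trace[OF assms(2)] assms(5) by (simp flip: of_real_sum)
qed (use assms in \<open>auto simp: overlap_def\<close>)

text \<open>The resolvent of the primed pair is the value of its form at some \<open>Y\<close>; the
  matching \<open>X\<close> bounds this value by the resolvent of the other pair. Comparing the
  resolvents at every \<open>t > 0\<close> then compares the entropies.\<close>

theorem rel_entropy_mono_if_var_form:
  assumes "state n \<rho>" "state n \<sigma>" "state m \<rho>'" "state m \<sigma>'"
    and dual: "\<And>t Y. 0 < t \<Longrightarrow> Y \<in> carrier_mat m m \<Longrightarrow>
      \<exists>X \<in> carrier_mat n n. var_form t \<rho>' \<sigma>' Y \<le> var_form t \<rho> \<sigma> X"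
  shows "rel_entropy \<sigma>' \<rho>' \<le> rel_entropy \<sigma> \<rho>"
proof -
  obtain U p where U: "spectral n \<rho> U p" and p: "\<And>i. i < n \<Longrightarrow> 0 \<le> p i"
    using assms(1) by (auto simp: state_def elim: psd_spectral)
  obtain V q where V: "spectral n \<sigma> V q" and q: "\<And>i. i < n \<Longrightarrow> 0 \<le> q i"
    using assms(2) by (auto simp: state_def elim: psd_spectral)
  obtain U' p' where U': "spectral m \<rho>' U' p'" and p': "\<And>i. i < m \<Longrightarrow> 0 \<le> p' i"
    using assms(3) by (auto simp: state_def elim: psd_spectral)
  obtain V' q' where V': "spectral m \<sigma>' V' q'" and q': "\<And>i. i < m \<Longrightarrow> 0 \<le> q' i"
    using assms(4) by (auto simp: state_def elim: psd_spectral)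
  have O: "overlap_data n (overlap U V) p q"
    using assms(2) by (intro state_overlap_data[OF U V p q]) (auto simp: state_def)
  have O': "overlap_data m (overlap U' V') p' q'"
    using assms(4) by (intro state_overlap_data[OF U' V' p' q']) (auto simp: state_def)
  have le: "resolvent m (overlap U' V') p' q' t \<le> resolvent n (overlap U V) p q t" if t: "0 < t" for t
  proof -
    obtain Y where Y: "Y \<in> carrier_mat m m" "var_form t \<rho>' \<sigma>' Y = resolvent m (overlap U' V') p' q' t"
      using var_form_attains_resolvent[OF U' V'] .
    obtain X where "X \<in> carrier_mat n n" "var_form t \<rho>' \<sigma>' Y \<le> var_form t \<rho> \<sigma> X"
      using dual[OF t Y(1)] by blast
    then show ?thesis using var_form_le_resolvent[OF U V p q t] Y(2) by fastforce
  qed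
  note R = resolvent_le_imp_entropy_le[OF O O' le]
  show ?thesis
    unfolding rel_entropy_spectral[OF U V] rel_entropy_spectral[OF U' V']
    using R unfolding overlap_data.dominated_def[OF O] overlap_data.dominated_def[OF O'] by auto
qed

subsection \<open>Block structure of composite systems\<close>

definition mat_block :: "nat \<Rightarrow> complex mat \<Rightarrow> nat \<Rightarrow> nat \<Rightarrow> complex mat" where
  "mat_block a Z i j = mat a a (\<lambda>(k, l). Z $$ (i * a + k, j * a + l))"

lemma mat_block_carrier [simp]: "mat_block a Z i j \<in> carrier_mat a a"
  by (simp add: mat_block_def)

lemma mat_block_dims [simp]: "dim_row (mat_block a Z i j) = a" "dim_col (mat_block a Z i j) = a"
  by (simp_all add: mat_block_def)

lemma mat_block_index [simp]:
  "k < a \<Longrightarrow> l < a \<Longrightarrow> mat_block a Z i j $$ (k, l) = Z $$ (i * a + k, j * a + l)"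
  by (simp add: mat_block_def)

lemma product_index_less: "i < r \<Longrightarrow> k < a \<Longrightarrow> i * a + k < r * (a :: nat)"
proof -
  assume "i < r" "k < a"
  then have "i * a + k < Suc i * a" by simp
  also have "\<dots> \<le> r * a" using \<open>i < r\<close> by (intro mult_le_mono1) simp
  finally show ?thesis .
qed

lemma product_index_div_mod:
  assumes "i < r * (a :: nat)"
  shows "i div a < r" "i mod a < a" "i div a * a + i mod a = i"
  using assms by (cases "a = 0"; simp add: less_mult_imp_div_less)+

lemma sum_product_index: "(\<Sum>i<r * a. f i) = (\<Sum>i<r. \<Sum>k<a. f (i * a + k :: nat))"
proof -
  have "(\<Sum>i<r * a. f i) = (\<Sum>(i, k)\<in>{..<r} \<times> {..<a}. f (i * a + k))"
  proof (rule sum.reindex_bij_witness[of _ "\<lambda>(i, k). i * a + k" "\<lambda>i. (i div a, i mod a)"], goal_cases)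
    case (2 i) then show ?case using product_index_div_mod(1,2)[of i r a] by simp
  next
    case (4 b) then show ?case by (auto intro: product_index_less)
  qed auto
  then show ?thesis by (simp add: sum.cartesian_product)
qed

lemma id_tensor_carrier [simp]: "id_tensor r a b T Z \<in> carrier_mat (r * b) (r * b)"
  by (simp add: id_tensor_def)

lemma id_tensor_dims [simp]:
  "dim_row (id_tensor r a b T Z) = r * b" "dim_col (id_tensor r a b T Z) = r * b"
  by (simp_all add: id_tensor_def)

lemma id_tensor_index:
  "i < r * b \<Longrightarrow> j < r * b \<Longrightarrow>
    id_tensor r a b T Z $$ (i, j) = T (mat_block a Z (i div b) (j div b)) $$ (i mod b, j mod b)"
  by (simp add: id_tensor_def mat_block_def)

lemma mat_block_id_tensor:
  assumes T: "T \<in> carrier_mat a a \<rightarrow> carrier_mat b b" and "i < r" "j < r"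
  shows "mat_block b (id_tensor r a b T Z) i j = T (mat_block a Z i j)"
proof -
  have TZ: "T (mat_block a Z i j) \<in> carrier_mat b b" using T by auto
  show ?thesis
  proof (rule eq_matI)
    fix k l assume "k < dim_row (T (mat_block a Z i j))" "l < dim_col (T (mat_block a Z i j))"
    then have kl: "k < b" "l < b" using TZ by auto
    then show "mat_block b (id_tensor r a b T Z) i j $$ (k, l) = T (mat_block a Z i j) $$ (k, l)"
      using assms(2,3) by (simp add: id_tensor_index product_index_less)
  next
    show "dim_row (mat_block b (id_tensor r a b T Z) i j) = dim_row (T (mat_block a Z i j))"
      "dim_col (mat_block b (id_tensor r a b T Z) i j) = dim_col (T (mat_block a Z i j))"
      using TZ by auto
  qed
qed

lemma mat_block_eqI:
  assumes "X \<in> carrier_mat (r * a) (r * a)" "Y \<in> carrier_mat (r * a) (r * a)"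
    and "\<And>i j. i < r \<Longrightarrow> j < r \<Longrightarrow> mat_block a X i j = mat_block a Y i j"
  shows "X = Y"
proof (rule eq_matI)
  fix i j assume "i < dim_row Y" "j < dim_col Y"
  then have ij: "i < r * a" "j < r * a" using assms by auto
  note i = product_index_div_mod[OF ij(1)] and j = product_index_div_mod[OF ij(2)]
  show "X $$ (i, j) = Y $$ (i, j)"
    using arg_cong[OF assms(3)[OF i(1) j(1)], of "\<lambda>M. M $$ (i mod a, j mod a)"] i j by simp
qed (use assms in auto)

lemma mat_block_nested:
  assumes "k < r" "l < r"
  shows "mat_block a (mat_block (r * a) Z i j) k l = mat_block a Z (i * r + k) (j * r + l)"
  using assms by (intro eq_matI) (simp_all add: product_index_less add_mult_distrib mult.assoc add.assoc)

text \<open>A block of a block is again a block, so two reference systems merge into one. This gives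
  complete positivity of \<open>id_tensor\<close> itself and allows \<open>C\<close> and
  \<open>B\<close> to serve jointly as a reference.\<close>

lemma id_tensor_id_tensor:
  assumes T: "T \<in> carrier_mat a a \<rightarrow> carrier_mat b b"
  shows "id_tensor s (r * a) (r * b) (id_tensor r a b T) Z = id_tensor (s * r) a b T Z"
proof (rule mat_block_eqI[of _ s "r * b"])
  fix i j assume ij: "i < s" "j < s"
  have "mat_block (r * b) (id_tensor s (r * a) (r * b) (id_tensor r a b T) Z) i j =
      id_tensor r a b T (mat_block (r * a) Z i j)"
    using ij by (intro mat_block_id_tensor funcsetI) simp_all
  also have "\<dots> = mat_block (r * b) (id_tensor (s * r) a b T Z) i j"
  proof (rule mat_block_eqI[of _ r b])
    fix k l assume kl: "k < r" "l < r"
    have "mat_block b (id_tensor r a b T (mat_block (r * a) Z i j)) k l = T (mat_block a (mat_block (r * a) Z i j) k l)"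
      by (rule mat_block_id_tensor[OF T kl])
    also have "\<dots> = mat_block b (id_tensor (s * r) a b T Z) (i * r + k) (j * r + l)"
      unfolding mat_block_nested[OF kl]
      by (rule mat_block_id_tensor[OF T, symmetric]) (use ij kl in \<open>simp_all add: product_index_less\<close>)
    finally show "mat_block b (id_tensor r a b T (mat_block (r * a) Z i j)) k l =
        mat_block b (mat_block (r * b) (id_tensor (s * r) a b T Z) i j) k l"
      unfolding mat_block_nested[OF kl] .
  qed simp_all
  finally show "mat_block (r * b) (id_tensor s (r * a) (r * b) (id_tensor r a b T) Z) i j =
    mat_block (r * b) (id_tensor (s * r) a b T Z) i j" .
next
  show "id_tensor (s * r) a b T Z \<in> carrier_mat (s * (r * b)) (s * (r * b))"
    using id_tensor_carrier[of "s * r" a b T Z] by (simp only: mult.assoc)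
qed simp

lemma id_tensor_comp:
  assumes F: "F \<in> carrier_mat a a \<rightarrow> carrier_mat b b" and G: "G \<in> carrier_mat b b \<rightarrow> carrier_mat c c"
  shows "id_tensor r a c (G \<circ> F) Z = id_tensor r b c G (id_tensor r a b F Z)"
proof -
  have "G \<circ> F \<in> carrier_mat a a \<rightarrow> carrier_mat c c" using F G by auto
  then show ?thesis
    by (intro mat_block_eqI[of "id_tensor r a c (G \<circ> F) Z" r c "id_tensor r b c G (id_tensor r a b F Z)"])
      (simp_all add: mat_block_id_tensor[OF F] mat_block_id_tensor[OF G] mat_block_id_tensor)
qed

text \<open>Trivial reference system: complete positivity specialises to positivity.\<close>

lemma id_tensor_one:
  assumes "T Z \<in> carrier_mat b b" "Z \<in> carrier_mat a a"
  shows "id_tensor 1 a b T Z = T Z"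
proof -
  have "mat_block a Z 0 0 = Z" using assms by (intro eq_matI) auto
  then show ?thesis using assms id_tensor_carrier[of 1 a b T Z]
    by (intro eq_matI) (simp_all add: id_tensor_def mat_block_def)
qed

lemma mat_trace_blocks:
  assumes "Z \<in> carrier_mat (r * a) (r * a)"
  shows "mat_trace Z = (\<Sum>i<r. mat_trace (mat_block a Z i i))"
  using assms by (auto simp: mat_trace_def sum_product_index mat_block_def intro!: sum.cong)

lemma trace_sandwich:
  assumes "A \<in> carrier_mat m k" "B \<in> carrier_mat m m" "C \<in> carrier_mat m k"
  shows "mat_trace (mat_adjoint A * B * C) = (\<Sum>l<k. \<Sum>i<m. \<Sum>j<m. cnj (A $$ (i, l)) * B $$ (i, j) * C $$ (j, l))"
proof -
  have "mat_trace (mat_adjoint A * B * C) = mat_trace (mat_adjoint A * (B * C))"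
    using assms by (simp add: assoc_mult_mat[of _ k m _ m _ k])
  also have "\<dots> = (\<Sum>l<k. \<Sum>i<m. mat_adjoint A $$ (l, i) * (B * C) $$ (i, l))"
    using assms by (intro mat_trace_mult) auto
  also have "\<dots> = (\<Sum>l<k. \<Sum>i<m. \<Sum>j<m. cnj (A $$ (i, l)) * B $$ (i, j) * C $$ (j, l))"
    using assms by (intro sum.cong refl)
      (simp add: index_mult_mat_sum[of _ m m _ k] sum_distrib_left mult.assoc del: index_mult_mat(1))
  finally show ?thesis .
qed

text \<open>Stacking the \<open>V i\<close> into a block column \<open>W\<close> turns the double
  sum into the trace of \<open>mat_adjoint W * Z * W\<close>, which is positive
  semidefinite.\<close>

lemma psd_block_trace:
  assumes Z: "psd (r * m) Z" and V: "\<And>i. i < r \<Longrightarrow> V i \<in> carrier_mat m k"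
  shows "0 \<le> Re (\<Sum>i<r. \<Sum>j<r. mat_trace (mat_adjoint (V i) * mat_block m Z i j * V j))"
proof -
  have Zc: "Z \<in> carrier_mat (r * m) (r * m)" using Z by (simp add: psd_def)
  define W where "W = mat (r * m) k (\<lambda>(i, j). V (i div m) $$ (i mod m, j))"
  have W: "W \<in> carrier_mat (r * m) k" by (simp add: W_def)
  have Wi: "W $$ (i * m + s, l) = V i $$ (s, l)" if "i < r" "s < m" "l < k" for i s l
    using that by (simp add: W_def product_index_less)
  have "mat_trace (mat_adjoint W * Z * W) =
    (\<Sum>l<k. \<Sum>i<r. \<Sum>s<m. \<Sum>j<r. \<Sum>t<m. cnj (W $$ (i * m + s, l)) * Z $$ (i * m + s, j * m + t) * W $$ (j * m + t, l))"
    unfolding trace_sandwich[OF W Zc W] sum_product_index ..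
  also have "\<dots> = (\<Sum>l<k. \<Sum>i<r. \<Sum>j<r. \<Sum>s<m. \<Sum>t<m. cnj (V i $$ (s, l)) * mat_block m Z i j $$ (s, t) * V j $$ (t, l))"
  proof (rule sum.cong[OF refl], rule sum.cong[OF refl])
    fix l i assume "l \<in> {..<k}" "i \<in> {..<r}"
    then show "(\<Sum>s<m. \<Sum>j<r. \<Sum>t<m. cnj (W $$ (i * m + s, l)) * Z $$ (i * m + s, j * m + t) * W $$ (j * m + t, l)) =
      (\<Sum>j<r. \<Sum>s<m. \<Sum>t<m. cnj (V i $$ (s, l)) * mat_block m Z i j $$ (s, t) * V j $$ (t, l))"
      by (subst sum.swap) (auto simp: Wi intro!: sum.cong)
  qed
  also have "\<dots> = (\<Sum>i<r. \<Sum>j<r. mat_trace (mat_adjoint (V i) * mat_block m Z i j * V j))"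
  proof -
    have "(\<Sum>i<r. \<Sum>j<r. mat_trace (mat_adjoint (V i) * mat_block m Z i j * V j)) =
      (\<Sum>i<r. \<Sum>j<r. \<Sum>l<k. \<Sum>s<m. \<Sum>t<m. cnj (V i $$ (s, l)) * mat_block m Z i j $$ (s, t) * V j $$ (t, l))"
      by (intro sum.cong refl trace_sandwich V) auto
    then show ?thesis by (subst sum.swap) (simp only: sum.swap[of _ "{..<r}" "{..<k}"])
  qed
  finally show ?thesis using psd_trace_nonneg[OF psd_conjugate[OF Z W]] by simp
qed

lemma psd_one: "psd n (1\<^sub>m n)"
proof -
  have "mat_adjoint (1\<^sub>m n) = (1\<^sub>m n :: complex mat)" by (rule eq_matI) auto
  moreover have "0 \<le> Re ((1\<^sub>m n *\<^sub>v v) \<bullet>c v)" if "v \<in> carrier_vec n" for v :: "complex vec"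
    using that by (simp add: cscalar_prod_sum[of _ n] sum_nonneg)
  ultimately show ?thesis by (simp add: psd_def)
qed

text \<open>Conjugating \<open>A\<close> by the block row made of the \<open>C i\<close> produces
  exactly these blocks.\<close>

lemma psd_gram:
  assumes "psd n A" "\<And>i. i < r \<Longrightarrow> C i \<in> carrier_mat n m"
  obtains Z where "psd (r * m) Z"
    "\<And>i j. i < r \<Longrightarrow> j < r \<Longrightarrow> mat_block m Z i j = mat_adjoint (C i) * A * C j"
proof
  define W where "W = mat n (r * m) (\<lambda>(i, j). C (j div m) $$ (i, j mod m))"
  have W: "W \<in> carrier_mat n (r * m)" by (simp add: W_def)
  have Ac: "A \<in> carrier_mat n n" using assms by (simp add: psd_def)
  show "psd (r * m) (mat_adjoint W * A * W)" by (rule psd_conjugate[OF assms(1) W])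
  fix i j assume ij: "i < r" "j < r"
  have entry: "(mat_adjoint X * A * Y) $$ (k, l) = (\<Sum>t<n. (\<Sum>s<n. cnj (X $$ (s, k)) * A $$ (s, t)) * Y $$ (t, l))"
    if "X \<in> carrier_mat n x" "Y \<in> carrier_mat n y" "k < x" "l < y" for X Y x y k l
  proof -
    have "(mat_adjoint X * A * Y) $$ (k, l) = (\<Sum>t<n. (mat_adjoint X * A) $$ (k, t) * Y $$ (t, l))"
      using that Ac by (intro index_mult_mat_sum) auto
    also have "\<dots> = (\<Sum>t<n. (\<Sum>s<n. mat_adjoint X $$ (k, s) * A $$ (s, t)) * Y $$ (t, l))"
      using that Ac by (intro sum.cong refl arg_cong2[of _ _ _ _ "(*)"] index_mult_mat_sum) auto
    finally show ?thesis using that by simp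
  qed
  show "mat_block m (mat_adjoint W * A * W) i j = mat_adjoint (C i) * A * C j"
  proof (rule eq_matI)
    fix k l assume "k < dim_row (mat_adjoint (C i) * A * C j)" "l < dim_col (mat_adjoint (C i) * A * C j)"
    then have kl: "k < m" "l < m" using assms(2)[OF ij(1)] assms(2)[OF ij(2)] by auto
    then show "mat_block m (mat_adjoint W * A * W) i j $$ (k, l) = (mat_adjoint (C i) * A * C j) $$ (k, l)"
      using ij by (simp add: entry[OF W W] entry[OF assms(2) assms(2)] product_index_less del: index_mult_mat(1))
        (simp add: W_def product_index_less)
  qed (use assms(2)[OF ij(1)] assms(2)[OF ij(2)] in auto)
qed

subsection \<open>Channels and their duals\<close>

lemma channelD:
  assumes "channel a b T"
  shows "\<And>X. X \<in> carrier_mat a a \<Longrightarrow> T X \<in> carrier_mat b b"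
    "\<And>X Y. X \<in> carrier_mat a a \<Longrightarrow> Y \<in> carrier_mat a a \<Longrightarrow> T (X + Y) = T X + T Y"
    "\<And>c X. X \<in> carrier_mat a a \<Longrightarrow> T (c \<cdot>\<^sub>m X) = c \<cdot>\<^sub>m T X"
    "\<And>X. X \<in> carrier_mat a a \<Longrightarrow> mat_trace (T X) = mat_trace X"
    "\<And>r Z. psd (r * a) Z \<Longrightarrow> psd (r * b) (id_tensor r a b T Z)"
  using assms unfolding channel_def by blast+

lemma channel_funcset: "channel a b T \<Longrightarrow> T \<in> carrier_mat a a \<rightarrow> carrier_mat b b"
  by (auto dest: channelD(1))

lemma channel_psd:
  assumes "channel a b T" "psd a X"
  shows "psd b (T X)"
proof -
  have X: "X \<in> carrier_mat a a" using assms(2) by (simp add: psd_def)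
  then have "id_tensor 1 a b T X = T X" using channelD(1)[OF assms(1)] by (intro id_tensor_one)
  then show ?thesis using channelD(5)[OF assms(1), of 1 X] assms(2) by simp
qed

lemma channel_state: "channel a b T \<Longrightarrow> state a \<rho> \<Longrightarrow> state b (T \<rho>)"
  using channel_psd channelD(4) unfolding state_def by (metis psd_def)

text \<open>The Gram matrix of the identity along \<open>(1, X)\<close> has \<open>X\<close> and its
  adjoint as off-diagonal blocks. Its image under the channel with a two-dimensional reference is
  Hermitian, so the images of these two blocks are adjoint to each other.\<close>

lemma channel_adjoint:
  assumes T: "channel a b T" and X: "X \<in> carrier_mat a a"
  shows "T (mat_adjoint X) = mat_adjoint (T X)"
proof -
  define C where "C i = (if i = 0 then 1\<^sub>m a else X)" for i :: nat
  have adj1: "mat_adjoint (1\<^sub>m a) = (1\<^sub>m a :: complex mat)" using psd_one by (simp add: psd_def)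
  have Cc: "\<And>i. i < 2 \<Longrightarrow> C i \<in> carrier_mat a a" using X by (simp add: C_def)
  obtain Z where Z: "psd (2 * a) Z"
    "\<And>i j. i < 2 \<Longrightarrow> j < 2 \<Longrightarrow> mat_block a Z i j = mat_adjoint (C i) * 1\<^sub>m a * C j"
    by (rule psd_gram[where C = C, OF psd_one Cc]) (assumption, rule that)
  have 01: "mat_block a Z 0 1 = X" and 10: "mat_block a Z 1 0 = mat_adjoint X"
    using Z(2)[of 0 1] Z(2)[of 1 0] X by (simp_all add: C_def adj1)
  let ?Z = "id_tensor 2 a b T Z"
  have herm: "mat_adjoint ?Z = ?Z" using channelD(5)[OF T Z(1)] unfolding psd_def by blast
  have "mat_block b ?Z 1 0 = mat_adjoint (mat_block b ?Z 0 1)"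
  proof (rule eq_matI)
    fix i j assume "i < dim_row (mat_adjoint (mat_block b ?Z 0 1))" "j < dim_col (mat_adjoint (mat_block b ?Z 0 1))"
    then have ij: "i < b" "j < b" by simp_all
    have "?Z $$ (b + i, j) = mat_adjoint ?Z $$ (b + i, j)" unfolding herm ..
    also have "\<dots> = cnj (?Z $$ (j, b + i))" using ij by (intro mat_adjoint_index) auto
    finally show "mat_block b ?Z 1 0 $$ (i, j) = mat_adjoint (mat_block b ?Z 0 1) $$ (i, j)"
      using ij by simp
  qed simp_all
  moreover have "mat_block b ?Z 1 0 = T (mat_adjoint X)"
    unfolding 10[symmetric] by (rule mat_block_id_tensor[OF channel_funcset[OF T]]) simp_all
  moreover have "mat_block b ?Z 0 1 = T X"
    unfolding 01[symmetric] by (rule mat_block_id_tensor[OF channel_funcset[OF T]]) simp_all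
  ultimately show ?thesis by simp
qed

definition mat_unit :: "nat \<Rightarrow> nat \<Rightarrow> nat \<Rightarrow> complex mat" where
  "mat_unit n i j = mat n n (\<lambda>(k, l). if k = i \<and> l = j then 1 else 0)"

lemma mat_unit_carrier [simp]: "mat_unit n i j \<in> carrier_mat n n"
  by (simp add: mat_unit_def)

lemma linear_functional_expansion:
  fixes L :: "complex mat \<Rightarrow> complex"
  assumes add: "\<And>X Y. X \<in> carrier_mat n n \<Longrightarrow> Y \<in> carrier_mat n n \<Longrightarrow> L (X + Y) = L X + L Y"
    and smult: "\<And>c X. X \<in> carrier_mat n n \<Longrightarrow> L (c \<cdot>\<^sub>m X) = c * L X"
    and X: "X \<in> carrier_mat n n"
  shows "L X = (\<Sum>i<n. \<Sum>j<n. X $$ (i, j) * L (mat_unit n i j))"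
proof -
  \<comment> \<open>The restriction of \<open>X\<close> to the positions in \<open>S\<close>; adding
    positions one at a time reduces the expansion to additivity and homogeneity.\<close>
  define res where "res S = mat n n (\<lambda>ij. if ij \<in> S then X $$ ij else 0)" for S
  have "L (res S) = (\<Sum>(i, j)\<in>S. X $$ (i, j) * L (mat_unit n i j))" if "finite S" "S \<subseteq> {..<n} \<times> {..<n}" for S
    using that
  proof (induction rule: finite_induct)
    case empty
    have "res {} = 0 \<cdot>\<^sub>m X" using X by (intro eq_matI) (auto simp: res_def)
    then show ?case using smult[OF X, of 0] by simp
  next
    case (insert x S)
    obtain i j where x: "x = (i, j)" by (cases x)
    have "res (insert x S) = X $$ (i, j) \<cdot>\<^sub>m mat_unit n i j + res S"
      using insert.hyps(2) by (intro eq_matI) (auto simp: res_def mat_unit_def x)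
    then have "L (res (insert x S)) = X $$ (i, j) * L (mat_unit n i j) + L (res S)"
      using add[of "X $$ (i, j) \<cdot>\<^sub>m mat_unit n i j" "res S"] smult[of "mat_unit n i j"] by (simp add: res_def)
    then show ?case using insert.IH insert.prems insert.hyps by (simp add: x)
  qed
  from this[of "{..<n} \<times> {..<n}"] have "L (res ({..<n} \<times> {..<n})) = (\<Sum>i<n. \<Sum>j<n. X $$ (i, j) * L (mat_unit n i j))"
    by (simp add: sum.cartesian_product)
  moreover have "res ({..<n} \<times> {..<n}) = X" using X by (intro eq_matI) (auto simp: res_def)
  ultimately show ?thesis by simp
qed

text \<open>The dual for the bilinear trace pairing. The unit has transposed indices because the
  trace of \<open>mat_unit a j i * K\<close> is \<open>K $$ (i, j)\<close>.\<close>

definition dual_map :: "nat \<Rightarrow> (complex mat \<Rightarrow> complex mat) \<Rightarrow> complex mat \<Rightarrow> complex mat" where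
  "dual_map a T Y = mat a a (\<lambda>(i, j). mat_trace (T (mat_unit a j i) * Y))"

lemma dual_map_carrier [simp]: "dual_map a T Y \<in> carrier_mat a a"
  by (simp add: dual_map_def)

lemma dual_map_dims [simp]: "dim_row (dual_map a T Y) = a" "dim_col (dual_map a T Y) = a"
  by (simp_all add: dual_map_def)

lemma trace_dual_map:
  assumes T: "channel a b T" and X: "X \<in> carrier_mat a a" and Y: "Y \<in> carrier_mat b b"
  shows "mat_trace (T X * Y) = mat_trace (X * dual_map a T Y)"
proof -
  note c = channelD(1)[OF T]
  have "mat_trace (T X * Y) = (\<Sum>i<a. \<Sum>j<a. X $$ (i, j) * mat_trace (T (mat_unit a i j) * Y))"
  proof (rule linear_functional_expansion[OF _ _ X])
    show "mat_trace (T (A + B) * Y) = mat_trace (T A * Y) + mat_trace (T B * Y)"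
      if "A \<in> carrier_mat a a" "B \<in> carrier_mat a a" for A B
      using c[OF that(1)] c[OF that(2)] Y
      by (simp add: channelD(2)[OF T that] add_mult_distrib_mat[of _ b b] mat_trace_add[of _ b])
    show "mat_trace (T (k \<cdot>\<^sub>m A) * Y) = k * mat_trace (T A * Y)"
      if "A \<in> carrier_mat a a" for k A
      unfolding channelD(3)[OF T that] mult_smult_assoc_mat[OF c[OF that] Y]
      using c[OF that] Y by (intro mat_trace_smult[of _ b]) simp
  qed
  also have "\<dots> = mat_trace (X * dual_map a T Y)"
    by (subst mat_trace_mult[OF X]) (auto simp: dual_map_def intro!: sum.cong)
  finally show ?thesis .
qed

lemma dual_map_adjoint:
  assumes T: "channel a b T" and Y: "Y \<in> carrier_mat b b"
  shows "dual_map a T (mat_adjoint Y) = mat_adjoint (dual_map a T Y)"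
proof (rule eq_matI)
  fix i j assume "i < dim_row (mat_adjoint (dual_map a T Y))" "j < dim_col (mat_adjoint (dual_map a T Y))"
  then have ij: "i < a" "j < a" by (auto simp: dual_map_def)
  have E: "mat_adjoint (mat_unit a i j) = mat_unit a j i" by (intro eq_matI) (auto simp: mat_unit_def)
  let ?M = "T (mat_unit a i j)"
  have M: "?M \<in> carrier_mat b b" using channelD(1)[OF T] by simp
  have "mat_trace (T (mat_unit a j i) * mat_adjoint Y) = mat_trace (mat_adjoint ?M * mat_adjoint Y)"
    using channel_adjoint[OF T, of "mat_unit a i j"] E by simp
  also have "\<dots> = mat_trace (mat_adjoint Y * mat_adjoint ?M)"
    using M Y by (intro mat_trace_comm[of _ b b]) auto
  also have "mat_adjoint Y * mat_adjoint ?M = mat_adjoint (?M * Y)"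
    using M Y by (simp add: mat_adjoint_mult[of _ b b _ b])
  also have "mat_trace \<dots> = cnj (mat_trace (?M * Y))" using M Y by (intro mat_trace_adjoint[of _ b]) auto
  finally show "dual_map a T (mat_adjoint Y) $$ (i, j) = mat_adjoint (dual_map a T Y) $$ (i, j)"
    using ij by (simp add: dual_map_def)
qed (auto simp: dual_map_def)

text \<open>The Kadison--Schwarz inequality \<open>\<Psi>(Y) \<Psi>(Y)\<^sup>* \<le> \<Psi>(Y Y\<^sup>*)\<close> for the dual map \<open>\<Psi>\<close>, tested
  against \<open>\<rho>\<close>. It only needs 2-positivity, applied to the Gram matrix of \<open>\<rho>\<close> along \<open>(1, \<Psi>(Y))\<close>.\<close>

lemma dual_map_schwarz:
  assumes T: "channel a b T" and \<rho>: "psd a \<rho>" and Y: "Y \<in> carrier_mat b b"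
  shows "Re (mat_trace (\<rho> * (dual_map a T Y * mat_adjoint (dual_map a T Y))))
    \<le> Re (mat_trace (T \<rho> * (Y * mat_adjoint Y)))"
proof -
  note c = channelD(1)[OF T]
  let ?K = "dual_map a T Y"
  have K: "?K \<in> carrier_mat a a" by simp
  have \<rho>c: "\<rho> \<in> carrier_mat a a" "mat_adjoint \<rho> = \<rho>" using \<rho> by (auto simp: psd_def)
  define C where "C i = (if i = 0 then 1\<^sub>m a else ?K)" for i :: nat
  have adj1: "mat_adjoint (1\<^sub>m n) = (1\<^sub>m n :: complex mat)" for n using psd_one by (simp add: psd_def)
  have Cc: "\<And>i. i < 2 \<Longrightarrow> C i \<in> carrier_mat a a" by (simp add: C_def)
  obtain Z where Z: "psd (2 * a) Z"
    "\<And>i j. i < 2 \<Longrightarrow> j < 2 \<Longrightarrow> mat_block a Z i j = mat_adjoint (C i) * \<rho> * C j"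
    by (rule psd_gram[where C = C, OF \<rho> Cc]) (assumption, rule that)
  \<comment> \<open>Testing the image of the Gram matrix at \<open>(Y, -1)\<close> yields four
    traces: the right-hand side of the claim, \<open>- cnj s\<close>, \<open>- s\<close> and
    \<open>s\<close>. Their real parts add up to the difference of the two sides, since
    \<open>s\<close> is the trace on the left-hand side.\<close>
  define V where "V i = (if i = 0 then Y else (-1) \<cdot>\<^sub>m 1\<^sub>m b)" for i :: nat
  let ?Z = "id_tensor 2 a b T Z"
  define tr where "tr i j = mat_trace (mat_adjoint (V i) * mat_block b ?Z i j * V j)" for i j
  have pos: "0 \<le> Re (\<Sum>i<2. \<Sum>j<2. tr i j)" unfolding tr_def
    using Y by (intro psd_block_trace channelD(5)[OF T Z(1)]) (auto simp: V_def)
  have blk: "mat_block b ?Z i j = T (mat_adjoint (C i) * \<rho> * C j)" if "i < 2" "j < 2" for i j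
    unfolding Z(2)[OF that, symmetric] by (rule mat_block_id_tensor[OF channel_funcset[OF T] that])
  define s where "s = mat_trace (mat_adjoint ?K * \<rho> * ?K)"
  have KrK: "mat_adjoint ?K * \<rho> * ?K \<in> carrier_mat a a" "mat_adjoint ?K * \<rho> \<in> carrier_mat a a"
    "\<rho> * ?K \<in> carrier_mat a a" using \<rho>c K by simp_all
  have adjV: "mat_adjoint (V 1) = (-1) \<cdot>\<^sub>m 1\<^sub>m b" by (intro eq_matI) (auto simp: V_def)
  have "tr 0 0 = mat_trace (mat_adjoint Y * (T \<rho> * Y))"
    using \<rho>c Y c[OF \<rho>c(1)] by (simp add: tr_def blk C_def V_def adj1 assoc_mult_mat[of _ b b _ b _ b])
  also have "\<dots> = mat_trace (T \<rho> * (Y * mat_adjoint Y))"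
    using \<rho>c Y c[OF \<rho>c(1)] by (subst mat_trace_comm[of _ b b]) (auto simp: assoc_mult_mat[of _ b b _ b _ b])
  finally have 00: "tr 0 0 = mat_trace (T \<rho> * (Y * mat_adjoint Y))" .
  \<comment> \<open>Duality turns the cross term into \<open>s\<close>, the same number that trace
    preservation gives for the lower diagonal block.\<close>
  have Ks: "mat_trace (T (mat_adjoint ?K * \<rho>) * Y) = s"
    unfolding s_def by (rule trace_dual_map[OF T KrK(2) Y])
  have 10: "tr 1 0 = - s"
  proof -
    have "tr 1 0 = mat_trace ((-1) \<cdot>\<^sub>m (T (mat_adjoint ?K * \<rho>) * Y))"
      unfolding tr_def adjV using c[OF KrK(2)] Y KrK(2)
      by (simp add: blk) (simp add: C_def V_def mult_smult_assoc_mat[of _ b b _ b])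
    then show ?thesis using c[OF KrK(2)] Y Ks by (simp add: mat_trace_smult[of _ b])
  qed
  have 01: "tr 0 1 = - cnj s"
  proof -
    have adj: "T (\<rho> * ?K) = mat_adjoint (T (mat_adjoint ?K * \<rho>))"
      using channel_adjoint[OF T KrK(2)] \<rho>c K by (simp add: mat_adjoint_mult[of _ a a _ a])
    have "tr 0 1 = mat_trace ((-1) \<cdot>\<^sub>m (mat_adjoint Y * T (\<rho> * ?K)))"
      unfolding tr_def using c[OF KrK(3)] Y \<rho>c
      by (simp add: blk) (simp add: C_def V_def adj1 mult_smult_distrib[of _ b b _ b])
    also have "\<dots> = - mat_trace (mat_adjoint Y * mat_adjoint (T (mat_adjoint ?K * \<rho>)))"
      using c[OF KrK(2)] Y by (simp add: mat_trace_smult[of _ b] adj)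
    also have "mat_adjoint Y * mat_adjoint (T (mat_adjoint ?K * \<rho>)) = mat_adjoint (T (mat_adjoint ?K * \<rho>) * Y)"
      using c[OF KrK(2)] Y by (simp add: mat_adjoint_mult[of _ b b _ b])
    also have "mat_trace \<dots> = cnj s"
      using c[OF KrK(2)] Y Ks by (simp add: mat_trace_adjoint[of _ b])
    finally show ?thesis .
  qed
  have 11: "tr 1 1 = s"
  proof -
    have "tr 1 1 = mat_trace ((-1) \<cdot>\<^sub>m ((-1) \<cdot>\<^sub>m T (mat_adjoint ?K * \<rho> * ?K)))"
      unfolding tr_def adjV using c[OF KrK(1)]
      by (simp add: blk) (simp add: C_def V_def mult_smult_assoc_mat[of _ b b _ b] mult_smult_distrib[of _ b b _ b])
    then show ?thesis using c[OF KrK(1)] channelD(4)[OF T KrK(1)] by (simp add: mat_trace_smult[of _ b] s_def)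
  qed
  have "s = mat_trace (\<rho> * (?K * mat_adjoint ?K))" unfolding s_def
    using \<rho>c K by (subst assoc_mult_mat[of _ a a _ a _ a], (simp; fail)+, subst mat_trace_comm[of _ a a])
      (auto simp: assoc_mult_mat[of _ a a _ a _ a])
  moreover have "(\<Sum>i<2. \<Sum>j<2. tr i j) = tr 0 0 + tr 0 1 + tr 1 0 + tr 1 1"
    by (simp add: numeral_2_eq_2)
  ultimately show ?thesis using pos 00 01 10 11 by simp
qed

theorem rel_entropy_data_processing:
  assumes T: "channel a b T" and \<rho>: "state a \<rho>" and \<sigma>: "state a \<sigma>"
  shows "rel_entropy (T \<sigma>) (T \<rho>) \<le> rel_entropy \<sigma> \<rho>"
proof (rule rel_entropy_mono_if_var_form[OF \<rho> \<sigma> channel_state[OF T \<rho>] channel_state[OF T \<sigma>]])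
  fix t :: real and Y :: "complex mat" assume t: "0 < t" and Y: "Y \<in> carrier_mat b b"
  let ?K = "dual_map a T Y"
  have p: "psd a \<rho>" "psd a \<sigma>" using \<rho> \<sigma> by (auto simp: state_def)
  then have \<sigma>c: "\<sigma> \<in> carrier_mat a a" by (simp add: psd_def)
  \<comment> \<open>Here the adjoint stands first, so the Schwarz inequality is used at
    \<open>mat_adjoint Y\<close>.\<close>
  have "Re (mat_trace (\<sigma> * (mat_adjoint ?K * ?K))) \<le> Re (mat_trace (T \<sigma> * (mat_adjoint Y * Y)))"
    using dual_map_schwarz[OF T p(2), of "mat_adjoint Y"] Y by (simp add: dual_map_adjoint[OF T Y])
  then have "t * Re (mat_trace (\<sigma> * (mat_adjoint ?K * ?K))) \<le> t * Re (mat_trace (T \<sigma> * (mat_adjoint Y * Y)))"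
    using t by simp
  then have "var_form t (T \<rho>) (T \<sigma>) Y \<le> var_form t \<rho> \<sigma> ?K"
    unfolding var_form_def using dual_map_schwarz[OF T p(1) Y] trace_dual_map[OF T \<sigma>c Y] by simp
  then show "\<exists>X\<in>carrier_mat a a. var_form t (T \<rho>) (T \<sigma>) Y \<le> var_form t \<rho> \<sigma> X"
    using dual_map_carrier by blast
qed

subsection \<open>Closure properties of channels\<close>

lemma mat_block_add:
  assumes "X \<in> carrier_mat (r * a) (r * a)" "Y \<in> carrier_mat (r * a) (r * a)" "i < r" "j < r"
  shows "mat_block a (X + Y) i j = mat_block a X i j + mat_block a Y i j"
  using assms by (intro eq_matI) (simp_all add: product_index_less)

lemma mat_block_smult:
  assumes "X \<in> carrier_mat (r * a) (r * a)" "i < r" "j < r"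
  shows "mat_block a (c \<cdot>\<^sub>m X) i j = c \<cdot>\<^sub>m mat_block a X i j"
  using assms by (intro eq_matI) (simp_all add: product_index_less)

text \<open>Positivity with a further reference of dimension \<open>s\<close> is positivity of
  \<open>T\<close> with a reference of dimension \<open>s * r\<close>; the other properties hold
  block by block.\<close>

lemma channel_id_tensor:
  assumes T: "channel a b T"
  shows "channel (r * a) (r * b) (id_tensor r a b T)"
proof -
  note c = channel_funcset[OF T]
  have add: "id_tensor r a b T (X + Y) = id_tensor r a b T X + id_tensor r a b T Y"
    if "X \<in> carrier_mat (r * a) (r * a)" "Y \<in> carrier_mat (r * a) (r * a)" for X Y
    by (rule mat_block_eqI[of _ r b, rotated 2])
      (simp_all add: mat_block_id_tensor[OF c] mat_block_add[of _ r] that channelD(2)[OF T])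
  have smult: "id_tensor r a b T (k \<cdot>\<^sub>m X) = k \<cdot>\<^sub>m id_tensor r a b T X"
    if "X \<in> carrier_mat (r * a) (r * a)" for X k
    by (rule mat_block_eqI[of _ r b, rotated 2])
      (simp_all add: mat_block_id_tensor[OF c] mat_block_smult[of _ r] that channelD(3)[OF T])
  have trace: "mat_trace (id_tensor r a b T X) = mat_trace X" if "X \<in> carrier_mat (r * a) (r * a)" for X
    unfolding mat_trace_blocks[OF that] mat_trace_blocks[OF id_tensor_carrier]
    by (intro sum.cong refl) (simp add: mat_block_id_tensor[OF c] channelD(4)[OF T])
  have "psd (s * (r * b)) (id_tensor s (r * a) (r * b) (id_tensor r a b T) Z)" if "psd (s * (r * a)) Z" for s Z
    unfolding id_tensor_id_tensor[OF c]
    using channelD(5)[OF T, of "s * r" Z] that by (simp only: mult.assoc)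
  then show ?thesis unfolding channel_def using add smult trace by simp
qed

lemma channel_comp:
  assumes F: "channel a b F" and G: "channel b c G"
  shows "channel a c (G \<circ> F)"
proof -
  have "psd (r * c) (id_tensor r a c (G \<circ> F) Z)" if "psd (r * a) Z" for r Z
    unfolding id_tensor_comp[OF channel_funcset[OF F] channel_funcset[OF G]]
    using channelD(5)[OF G] channelD(5)[OF F] that by blast
  then show ?thesis unfolding channel_def
    using channelD(1-4)[OF F] channelD(1-4)[OF G] by simp
qed

section \<open>Partial traces as channels\<close>

definition trace_map :: "complex mat \<Rightarrow> complex mat" where
  "trace_map X = mat 1 1 (\<lambda>_. mat_trace X)"

lemma channel_trace_map: "channel a 1 trace_map"
proof -
  have psd: "psd (r * 1) (id_tensor r a 1 trace_map Z)" if Z: "psd (r * a) Z" for r Z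
  proof -
    define P where "P = id_tensor r a 1 trace_map Z"
    have Zc: "Z \<in> carrier_mat (r * a) (r * a)" "mat_adjoint Z = Z" using Z by (auto simp: psd_def)
    have Pc: "P \<in> carrier_mat r r" using id_tensor_carrier[of r a 1 trace_map Z] by (simp add: P_def)
    then have dims: "dim_row P = r" "dim_col P = r" by auto
    have P_index: "P $$ (i, j) = mat_trace (mat_block a Z i j)" if "i < r" "j < r" for i j
      using that by (simp add: P_def id_tensor_index trace_map_def)
    have "mat_adjoint P = P"
    proof (rule eq_matI)
      fix i j assume "i < dim_row P" "j < dim_col P"
      then have ij: "i < r" "j < r" using dims by simp_all
      have "cnj (Z $$ (j * a + k, i * a + k)) = Z $$ (i * a + k, j * a + k)" if "k < a" for k
        using mat_adjoint_index[of "i * a + k" Z "j * a + k"] Zc ij that by (simp add: product_index_less)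
      then show "mat_adjoint P $$ (i, j) = P $$ (i, j)" using ij dims P_index by (simp add: mat_trace_def)
    qed (simp_all add: dims)
    moreover have "0 \<le> Re ((P *\<^sub>v v) \<bullet>c v)" if v: "v \<in> carrier_vec (r * 1)" for v
    proof -
      have v: "v \<in> carrier_vec r" using v by simp
      \<comment> \<open>Testing \<open>Z\<close> against the scalar operators
        \<open>v $ i \<cdot>\<^sub>m 1\<^sub>m a\<close> recovers the quadratic form of the traced
        matrix at \<open>v\<close>.\<close>
      have t: "mat_trace (mat_adjoint (v $ i \<cdot>\<^sub>m 1\<^sub>m a) * mat_block a Z i j * (v $ j \<cdot>\<^sub>m 1\<^sub>m a))
          = cnj (v $ i) * (mat_trace (mat_block a Z i j) * v $ j)" for i j
      proof -
        have "mat_adjoint (v $ i \<cdot>\<^sub>m 1\<^sub>m a) = cnj (v $ i) \<cdot>\<^sub>m 1\<^sub>m a" by (intro eq_matI) auto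
        then show ?thesis
          by (simp add: mult_smult_assoc_mat[of _ a a _ a] mult_smult_distrib[of _ a a _ a] mat_trace_smult[of _ a])
      qed
      have "(P *\<^sub>v v) \<bullet>c v = (\<Sum>i<r. \<Sum>j<r. cnj (v $ i) * (mat_trace (mat_block a Z i j) * v $ j))"
        using v Pc by (subst cscalar_prod_sum[of _ r])
          (auto simp: index_mult_mat_vec_sum[of _ r r] P_index sum_distrib_left mult_ac simp del: index_mult_mat_vec intro!: sum.cong)
      then show ?thesis using psd_block_trace[OF Z, of "\<lambda>i. v $ i \<cdot>\<^sub>m 1\<^sub>m a" a] by (simp add: t)
    qed
    ultimately show ?thesis using Pc unfolding psd_def P_def[symmetric] by simp
  qed
  show ?thesis unfolding channel_def
  proof (intro conjI ballI allI impI psd)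
    show "trace_map X \<in> carrier_mat 1 1" for X by (simp add: trace_map_def)
    show "trace_map (X + Y) = trace_map X + trace_map Y" if "X \<in> carrier_mat a a" "Y \<in> carrier_mat a a" for X Y
      using that by (intro eq_matI) (simp_all add: trace_map_def mat_trace_add[of _ a])
    show "trace_map (c \<cdot>\<^sub>m X) = c \<cdot>\<^sub>m trace_map X" if "X \<in> carrier_mat a a" for X c
      using that by (intro eq_matI) (simp_all add: trace_map_def mat_trace_smult[of _ a])
    show "mat_trace (trace_map X) = mat_trace X" for X
      by (simp add: trace_map_def mat_trace_def)
  qed
qed

text \<open>Reading the partial trace as the trace channel with a reference makes it inherit
  complete positivity and the merging of references.\<close>

lemma ptrace_snd_eq: "ptrace_snd x y = id_tensor x y 1 trace_map"
proof
  fix Z show "ptrace_snd x y Z = id_tensor x y 1 trace_map Z"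
    by (intro eq_matI) (simp_all add: ptrace_snd_def id_tensor_index trace_map_def mat_trace_def)
qed

lemma channel_ptrace_snd: "channel (x * y) x (ptrace_snd x y)"
  unfolding ptrace_snd_eq using channel_id_tensor[OF channel_trace_map, of x y] by simp

lemma id_tensor_ptrace_snd:
  "id_tensor c (b * d) b (ptrace_snd b d) Z = ptrace_snd (c * b) d Z"
  unfolding ptrace_snd_eq
  using id_tensor_id_tensor[OF channel_funcset[OF channel_trace_map], of c b d Z] by simp

lemma psd_add: "psd n A \<Longrightarrow> psd n B \<Longrightarrow> psd n (A + B)"
proof -
  assume A: "psd n A" and B: "psd n B"
  have c: "A \<in> carrier_mat n n" "B \<in> carrier_mat n n" using A B by (auto simp: psd_def)
  have "mat_adjoint (A + B) = mat_adjoint A + mat_adjoint B" using c by (intro eq_matI) auto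
  moreover have "((A + B) *\<^sub>v v) \<bullet>c v = (A *\<^sub>v v) \<bullet>c v + (B *\<^sub>v v) \<bullet>c v" if "v \<in> carrier_vec n" for v
    using c that by (simp add: add_mult_distrib_mat_vec[of _ n n] add_scalar_prod_distrib[of _ n])
  ultimately show ?thesis using A B unfolding psd_def by auto
qed

lemma psd_zero: "psd n (0\<^sub>m n n)"
proof -
  have "mat_adjoint (0\<^sub>m n n) = (0\<^sub>m n n :: complex mat)" by (intro eq_matI) auto
  moreover have "0\<^sub>m n n *\<^sub>v v = (0\<^sub>v n :: complex vec)" if "v \<in> carrier_vec n" for v
    using that by (intro eq_vecI) auto
  ultimately show ?thesis unfolding psd_def by auto
qed

lemma psd_mat_block:
  assumes Z: "psd (r * a) Z" and i: "i < r"
  shows "psd a (mat_block a Z i i)"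
proof -
  have Zc: "Z \<in> carrier_mat (r * a) (r * a)" using Z by (simp add: psd_def)
  \<comment> \<open>The isometric embedding of the \<open>i\<close>-th block; compressing
    \<open>Z\<close> by it yields the diagonal block.\<close>
  define C where "C = mat (r * a) a (\<lambda>(k, l). if k = i * a + l then 1 else 0 :: complex)"
  have C: "C \<in> carrier_mat (r * a) a" by (simp add: C_def)
  have "mat_adjoint C * Z * C = mat_block a Z i i"
  proof (rule eq_matI)
    fix k l assume "k < dim_row (mat_block a Z i i)" "l < dim_col (mat_block a Z i i)"
    then have kl: "k < a" "l < a" by simp_all
    have CZ: "(mat_adjoint C * Z) $$ (k, t) = Z $$ (i * a + k, t)" if "t < r * a" for t
    proof -
      have "(mat_adjoint C * Z) $$ (k, t) = (\<Sum>s<r * a. mat_adjoint C $$ (k, s) * Z $$ (s, t))"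
        using C Zc kl that by (intro index_mult_mat_sum) auto
      also have "\<dots> = (\<Sum>s<r * a. if s = i * a + k then Z $$ (s, t) else 0)"
        using kl by (intro sum.cong) (auto simp: C_def)
      finally show ?thesis using i kl by (simp add: product_index_less)
    qed
    have "(mat_adjoint C * Z * C) $$ (k, l) = (\<Sum>t<r * a. (mat_adjoint C * Z) $$ (k, t) * C $$ (t, l))"
      using C Zc kl by (intro index_mult_mat_sum) auto
    also have "\<dots> = (\<Sum>t<r * a. if t = i * a + l then Z $$ (i * a + k, t) else 0)"
      using kl by (intro sum.cong refl, subst CZ) (auto simp: C_def)
    also have "\<dots> = Z $$ (i * a + k, i * a + l)" using i kl by (simp add: product_index_less)
    finally show "(mat_adjoint C * Z * C) $$ (k, l) = mat_block a Z i i $$ (k, l)" using kl by simp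
  qed (use C in auto)
  then show ?thesis using psd_conjugate[OF Z C] by simp
qed

section \<open>The partial trace over the first factor\<close>

lemma ptrace_fst_carrier [simp]: "ptrace_fst c a Z \<in> carrier_mat a a"
  by (simp add: ptrace_fst_def)

lemma ptrace_fst_0: "ptrace_fst 0 a Z = 0\<^sub>m a a"
  by (intro eq_matI) (auto simp: ptrace_fst_def)

text \<open>This partial trace is the sum of the diagonal blocks. Splitting off the last one lets
  its properties follow by induction from additivity.\<close>

lemma ptrace_fst_Suc: "ptrace_fst (Suc c) a Z = ptrace_fst c a Z + mat_block a Z c c"
  by (intro eq_matI) (auto simp: ptrace_fst_def)

lemma ptrace_fst_state:
  assumes "state (c * a) \<rho>"
  shows "state a (ptrace_fst c a \<rho>)"
proof -
  have \<rho>: "psd (c * a) \<rho>" and "mat_trace \<rho> = 1" using assms by (auto simp: state_def)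
  then have tr: "(\<Sum>i<c. mat_trace (mat_block a \<rho> i i)) = 1"
    using mat_trace_blocks[of \<rho> c a] by (simp add: psd_def)
  \<comment> \<open>For \<open>k < c\<close> this is only a partial sum of diagonal blocks of the
    same \<rho>; the positions of the blocks depend on \<open>a\<close> alone.\<close>
  have "psd a (ptrace_fst k a \<rho>)" if "k \<le> c" for k using that
    by (induction k) (auto simp: ptrace_fst_0 ptrace_fst_Suc psd_zero intro!: psd_add psd_mat_block[OF \<rho>])
  moreover have "mat_trace (ptrace_fst k a \<rho>) = (\<Sum>i<k. mat_trace (mat_block a \<rho> i i))" for k
    by (induction k) (simp_all add: ptrace_fst_0 ptrace_fst_Suc mat_trace_add[of _ a], simp add: mat_trace_def)
  ultimately show ?thesis using tr unfolding state_def by simp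
qed

lemma ptrace_fst_id_tensor:
  assumes T: "channel a b T"
  shows "ptrace_fst c b (id_tensor c a b T Z) = T (ptrace_fst c a Z)"
proof -
  have "ptrace_fst k b (id_tensor c a b T Z) = T (ptrace_fst k a Z)" if "k \<le> c" for k
    using that
  proof (induction k)
    case 0
    have "T (0\<^sub>m a a) = T (0 \<cdot>\<^sub>m 0\<^sub>m a a)" by simp
    also have "\<dots> = 0 \<cdot>\<^sub>m T (0\<^sub>m a a)" by (rule channelD(3)[OF T]) simp
    also have "\<dots> = 0\<^sub>m b b" using channelD(1)[OF T, of "0\<^sub>m a a"] by (intro eq_matI) auto
    finally show ?case by (simp add: ptrace_fst_0)
  next
    case (Suc k)
    then show ?case
      by (simp add: ptrace_fst_Suc channelD(2)[OF T] mat_block_id_tensor[OF channel_funcset[OF T]])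
  qed
  then show ?thesis by simp
qed

text \<open>Trace preservation: acting on one factor leaves the marginal of the other
  unchanged.\<close>

lemma ptrace_snd_id_tensor:
  assumes T: "channel a b T"
  shows "ptrace_snd c b (id_tensor c a b T Z) = ptrace_snd c a Z"
proof -
  note tm = channel_funcset[OF channel_trace_map]
  have "trace_map (T X) = trace_map X" if "X \<in> carrier_mat a a" for X
    using channelD(4)[OF T that] by (simp add: trace_map_def)
  then show ?thesis unfolding ptrace_snd_eq
    by (intro mat_block_eqI[of _ c 1, rotated 2, OF _ id_tensor_carrier id_tensor_carrier])
      (simp add: mat_block_id_tensor[OF tm] mat_block_id_tensor[OF channel_funcset[OF T]] del: One_nat_def)
qed

section \<open>Tensor products of states\<close>

lemma tensor_mat_carrier:
  "A \<in> carrier_mat n m \<Longrightarrow> B \<in> carrier_mat k l \<Longrightarrow> tensor_mat A B \<in> carrier_mat (n * k) (m * l)"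
  by (auto simp: tensor_mat_def)

lemma tensor_mat_index:
  assumes "A \<in> carrier_mat n m" "B \<in> carrier_mat k l" "i < n * k" "j < m * l"
  shows "tensor_mat A B $$ (i, j) = A $$ (i div k, j div l) * B $$ (i mod k, j mod l)"
  using assms by (auto simp: tensor_mat_def)

lemma tensor_mat_mult:
  assumes A: "A \<in> carrier_mat n m" and C: "C \<in> carrier_mat m n'"
    and B: "B \<in> carrier_mat k l" and D: "D \<in> carrier_mat l k'"
  shows "tensor_mat A B * tensor_mat C D = tensor_mat (A * C) (B * D)"
proof (rule eq_matI)
  have AC: "A * C \<in> carrier_mat n n'" and BD: "B * D \<in> carrier_mat k k'" using assms by auto
  note AB = tensor_mat_carrier[OF A B] and CD = tensor_mat_carrier[OF C D]
  fix i j assume "i < dim_row (tensor_mat (A * C) (B * D))" "j < dim_col (tensor_mat (A * C) (B * D))"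
  then have ij: "i < n * k" "j < n' * k'" using tensor_mat_carrier[OF AC BD] by auto
  note i = product_index_div_mod[OF ij(1)] and j = product_index_div_mod[OF ij(2)]
  have "(tensor_mat A B * tensor_mat C D) $$ (i, j) =
      (\<Sum>x<m. \<Sum>y<l. tensor_mat A B $$ (i, x * l + y) * tensor_mat C D $$ (x * l + y, j))"
    using index_mult_mat_sum[OF AB CD ij] by (simp add: sum_product_index)
  also have "\<dots> = (\<Sum>x<m. \<Sum>y<l. (A $$ (i div k, x) * C $$ (x, j div k')) * (B $$ (i mod k, y) * D $$ (y, j mod k')))"
    using ij by (intro sum.cong refl) (simp add: tensor_mat_index[OF A B] tensor_mat_index[OF C D] product_index_less)
  also have "\<dots> = (A * C) $$ (i div k, j div k') * (B * D) $$ (i mod k, j mod k')"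
    unfolding index_mult_mat_sum[OF A C i(1) j(1)] index_mult_mat_sum[OF B D i(2) j(2)]
    by (simp add: sum_product)
  also have "\<dots> = tensor_mat (A * C) (B * D) $$ (i, j)" by (rule tensor_mat_index[OF AC BD ij, symmetric])
  finally show "(tensor_mat A B * tensor_mat C D) $$ (i, j) = tensor_mat (A * C) (B * D) $$ (i, j)" .
qed (use assms in \<open>auto simp: tensor_mat_def\<close>)

lemma tensor_mat_adjoint: "mat_adjoint (tensor_mat A B) = tensor_mat (mat_adjoint A) (mat_adjoint B)"
proof (rule eq_matI)
  fix i j assume "i < dim_row (tensor_mat (mat_adjoint A) (mat_adjoint B))"
    "j < dim_col (tensor_mat (mat_adjoint A) (mat_adjoint B))"
  then have ij: "i < dim_col A * dim_col B" "j < dim_row A * dim_row B" by (auto simp: tensor_mat_def)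
  note product_index_div_mod[OF ij(1)] product_index_div_mod[OF ij(2)]
  then show "mat_adjoint (tensor_mat A B) $$ (i, j) = tensor_mat (mat_adjoint A) (mat_adjoint B) $$ (i, j)"
    using ij by (simp add: tensor_mat_def)
qed (auto simp: tensor_mat_def)

text \<open>Take the square roots of the eigenvalues: \<open>K\<close> is their diagonal matrix
  times \<open>mat_adjoint U\<close>.\<close>

lemma psd_factor:
  assumes "psd n A"
  obtains K where "K \<in> carrier_mat n n" "A = mat_adjoint K * K"
proof -
  obtain U d where U: "spectral n A U d" and d: "\<And>i. i < n \<Longrightarrow> 0 \<le> d i"
    using assms by (auto elim: psd_spectral)
  have Uu: "unitary n U" and A: "A = U * mat_diag n (\<lambda>i. complex_of_real (d i)) * mat_adjoint U"
    using U by (auto simp: spectral_def)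
  note Ud = unitaryD[OF Uu]
  define S where "S = mat_diag n (\<lambda>i. complex_of_real (sqrt (d i)))"
  have S: "S \<in> carrier_mat n n" by (simp add: S_def)
  have Sa: "mat_adjoint S = S" by (intro eq_matI) (auto simp: S_def mat_diag_def)
  have SS: "S * S = mat_diag n (\<lambda>i. complex_of_real (d i))"
    unfolding S_def mat_diag_diag using d
    by (intro eq_matI) (auto simp: mat_diag_def abs_of_nonneg simp flip: of_real_mult)
  have "mat_adjoint (S * mat_adjoint U) * (S * mat_adjoint U) = U * (S * S) * mat_adjoint U"
    using S Ud(1,2) by (simp add: mat_adjoint_mult[of _ n n _ n] Sa assoc_mult_mat[of _ n n _ n _ n])
  then have "A = mat_adjoint (S * mat_adjoint U) * (S * mat_adjoint U)" unfolding A SS ..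
  then show ?thesis using that[of "S * mat_adjoint U"] S Ud by simp
qed

text \<open>Factor both operators; the mixed product rule then writes the tensor product as the
  adjoint of \<open>tensor_mat K L\<close> times \<open>tensor_mat K L\<close>.\<close>

lemma psd_tensor_mat:
  assumes "psd n A" "psd m B"
  shows "psd (n * m) (tensor_mat A B)"
proof -
  obtain K where K: "K \<in> carrier_mat n n" "A = mat_adjoint K * K" by (rule psd_factor[OF assms(1)])
  obtain L where L: "L \<in> carrier_mat m m" "B = mat_adjoint L * L" by (rule psd_factor[OF assms(2)])
  note KL = tensor_mat_carrier[OF K(1) L(1)]
  have "tensor_mat A B = mat_adjoint (tensor_mat K L) * tensor_mat K L"
    unfolding tensor_mat_adjoint K(2) L(2) using K(1) L(1)
    by (intro tensor_mat_mult[symmetric, of _ n n _ n _ m m _ m]) auto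
  also have "\<dots> = mat_adjoint (tensor_mat K L) * 1\<^sub>m (n * m) * tensor_mat K L" using KL by simp
  finally show ?thesis using psd_conjugate[OF psd_one KL] by simp
qed

lemma mat_block_tensor_mat:
  assumes "A \<in> carrier_mat r r" "B \<in> carrier_mat a a" "i < r" "j < r"
  shows "mat_block a (tensor_mat A B) i j = A $$ (i, j) \<cdot>\<^sub>m B"
  using assms by (intro eq_matI) (auto simp: tensor_mat_index[of A r r B a a] product_index_less)

lemma id_tensor_tensor_mat:
  assumes T: "channel a b T" and A: "A \<in> carrier_mat r r" and B: "B \<in> carrier_mat a a"
  shows "id_tensor r a b T (tensor_mat A B) = tensor_mat A (T B)"
  by (rule mat_block_eqI[of _ r b, OF _ tensor_mat_carrier[OF A channelD(1)[OF T B]]])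
    (simp_all add: mat_block_id_tensor[OF channel_funcset[OF T]] mat_block_tensor_mat[OF A B]
      mat_block_tensor_mat[OF A channelD(1)[OF T B]] channelD(3)[OF T B])

lemma state_tensor_mat:
  assumes "state n A" "state m B"
  shows "state (n * m) (tensor_mat A B)"
proof -
  have A: "A \<in> carrier_mat n n" "mat_trace A = 1" and B: "B \<in> carrier_mat m m" "mat_trace B = 1"
    using assms by (auto simp: state_def psd_def)
  have "mat_trace (tensor_mat A B) = (\<Sum>i<n. mat_trace (A $$ (i, i) \<cdot>\<^sub>m B))"
    unfolding mat_trace_blocks[OF tensor_mat_carrier[OF A(1) B(1)]]
    by (intro sum.cong refl) (simp add: mat_block_tensor_mat[OF A(1) B(1)])
  also have "\<dots> = 1" using A B by (simp add: mat_trace_smult[of _ m]) (simp add: mat_trace_def)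
  finally show ?thesis using psd_tensor_mat assms by (auto simp: state_def)
qed

text \<open>The product of the output marginals is the image of the product of the input marginals,
  so contraction of mutual information is contraction of a relative entropy under a single
  channel.\<close>

lemma mutual_info_id_tensor:
  assumes T: "channel a b T"
  shows "mutual_info c b (id_tensor c a b T \<rho>) =
    rel_entropy (id_tensor c a b T \<rho>)
      (id_tensor c a b T (tensor_mat (ptrace_snd c a \<rho>) (ptrace_fst c a \<rho>)))"
proof -
  have "ptrace_snd c a \<rho> \<in> carrier_mat c c" by (simp add: ptrace_snd_def)
  then show ?thesis unfolding mutual_info_def
    by (simp add: ptrace_fst_id_tensor[OF T] ptrace_snd_id_tensor[OF T] id_tensor_tensor_mat[OF T])
qed

subsection \<open>Bounds on contraction coefficients\<close>

lemma rel_entropy_self: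
  assumes "psd n \<rho>"
  shows "rel_entropy \<rho> \<rho> = 0"
proof -
  obtain U d where U: "spectral n \<rho> U d" using psd_spectral[OF assms] by blast
  have "mat_log \<rho> \<in> carrier_mat n n" unfolding mat_log_eq by (rule herm_fun_carrier[OF U])
  then have "\<rho> * (mat_log \<rho> - mat_log \<rho>) = 0\<^sub>m n n"
    using assms by (simp add: minus_r_inv_mat psd_def right_mult_zero_mat[of \<rho> n n n])
  then show ?thesis by (simp add: rel_entropy_def mat_trace_def zero_ereal_def)
qed

text \<open>Data processing for the full trace, which sends both states to the same 1 by 1
  matrix.\<close>

lemma rel_entropy_nonneg:
  assumes "state n \<rho>" "state n \<sigma>"
  shows "0 \<le> rel_entropy \<sigma> \<rho>"
proof -
  have "trace_map \<sigma> = trace_map \<rho>" using assms by (simp add: trace_map_def state_def)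
  moreover have "psd 1 (trace_map \<rho>)" using assms channel_psd[OF channel_trace_map, of n \<rho>] by (simp add: state_def)
  ultimately show ?thesis
    using rel_entropy_data_processing[OF channel_trace_map assms] rel_entropy_self by simp
qed

text \<open>The condition \<open>0 \<le> C\<close> covers the case without admissible pairs, where
  \<open>sup_ratio\<close> is 0.\<close>

lemma sup_ratio_le:
  assumes "\<And>p q. (p, q) \<in> P \<Longrightarrow> 0 < q \<Longrightarrow> q < \<infinity> \<Longrightarrow> p \<le> q * C" "0 \<le> C"
  shows "sup_ratio P \<le> C"
proof -
  have "p / q \<le> C" if "(p, q) \<in> P" "0 < q" "q < \<infinity>" for p q
    using assms(1)[OF that] that by (subst ereal_divide_le_pos) auto
  then show ?thesis using assms(2) unfolding sup_ratio_def Let_def by (auto intro!: Sup_least)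
qed

lemma le_sup_ratio:
  assumes "(p, q) \<in> P" "0 < q" "q < \<infinity>"
  shows "p \<le> q * sup_ratio P"
proof -
  have "p / q \<le> sup_ratio P" unfolding sup_ratio_def Let_def using assms by (auto intro!: Sup_upper)
  then show ?thesis using assms by (subst (asm) ereal_divide_le_pos) auto
qed

lemma sup_ratio_nonneg:
  assumes "\<And>p q. (p, q) \<in> P \<Longrightarrow> 0 < q \<Longrightarrow> q < \<infinity> \<Longrightarrow> 0 \<le> p"
  shows "0 \<le> sup_ratio P"
proof (cases "\<exists>p q. (p, q) \<in> P \<and> 0 < q \<and> q < \<infinity>")
  case True
  then obtain p q where pq: "(p, q) \<in> P" "0 < q" "q < \<infinity>" by blast
  have "0 \<le> p / q" using assms[OF pq] pq by (simp add: zero_le_divide_ereal)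
  also have "\<dots> \<le> sup_ratio P" unfolding sup_ratio_def Let_def using pq by (auto intro!: Sup_upper)
  finally show ?thesis .
next
  case False
  then have "{p / q | p q. (p, q) \<in> P \<and> 0 < q \<and> q < \<infinity>} = {}" by blast
  then show ?thesis unfolding sup_ratio_def Let_def by simp
qed

text \<open>All three are data processing. For the middle one, tracing out the output of
  \<open>R\<close> gives the same marginal as tracing out its input.\<close>

lemma rel_entropy_chain:
  assumes R: "channel d e R" and st: "state (r * d) \<rho>" "state (r * d) \<sigma>"
  shows "0 \<le> rel_entropy (ptrace_snd r d \<rho>) (ptrace_snd r d \<sigma>)"
    "rel_entropy (ptrace_snd r d \<rho>) (ptrace_snd r d \<sigma>) \<le> rel_entropy (id_tensor r d e R \<rho>) (id_tensor r d e R \<sigma>)"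
    "rel_entropy (id_tensor r d e R \<rho>) (id_tensor r d e R \<sigma>) \<le> rel_entropy \<rho> \<sigma>"
proof -
  note I = channel_id_tensor[OF R, of r]
  show "0 \<le> rel_entropy (ptrace_snd r d \<rho>) (ptrace_snd r d \<sigma>)"
    using channel_state[OF channel_ptrace_snd] st by (intro rel_entropy_nonneg)
  show "rel_entropy (ptrace_snd r d \<rho>) (ptrace_snd r d \<sigma>) \<le> rel_entropy (id_tensor r d e R \<rho>) (id_tensor r d e R \<sigma>)"
    using rel_entropy_data_processing[OF channel_ptrace_snd channel_state[OF I st(2)] channel_state[OF I st(1)]]
    by (simp add: ptrace_snd_id_tensor[OF R])
  show "rel_entropy (id_tensor r d e R \<rho>) (id_tensor r d e R \<sigma>) \<le> rel_entropy \<rho> \<sigma>"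
    by (rule rel_entropy_data_processing[OF I st(2,1)])
qed

lemma eta_Delta_bounds:
  assumes R: "channel d e R"
  shows "0 \<le> eta_Delta d e R" "eta_Delta d e R \<le> 1"
proof -
  let ?S = "{(rel_entropy (id_tensor r d e R \<rho>) (id_tensor r d e R \<sigma>)
         - rel_entropy (ptrace_snd r d \<rho>) (ptrace_snd r d \<sigma>),
       rel_entropy \<rho> \<sigma> - rel_entropy (ptrace_snd r d \<rho>) (ptrace_snd r d \<sigma>)) | r \<rho> \<sigma>.
     0 < r \<and> state (r * d) \<rho> \<and> state (r * d) \<sigma>}"
  have "0 \<le> p \<and> p \<le> q" if pq: "(p, q) \<in> ?S" "q < \<infinity>" for p q
  proof -
    from pq obtain r \<rho> \<sigma> where st: "state (r * d) \<rho>" "state (r * d) \<sigma>"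
      and p: "p = rel_entropy (id_tensor r d e R \<rho>) (id_tensor r d e R \<sigma>) - rel_entropy (ptrace_snd r d \<rho>) (ptrace_snd r d \<sigma>)"
      and q: "q = rel_entropy \<rho> \<sigma> - rel_entropy (ptrace_snd r d \<rho>) (ptrace_snd r d \<sigma>)" by blast
    \<comment> \<open>Since \<open>\<infinity> - \<infinity> = \<infinity>\<close>, a finite
      \<open>q\<close> forces the undivided entropy to be finite, hence all three are; the rest is
      real arithmetic.\<close>
    show ?thesis using rel_entropy_chain[OF R st] pq(2) unfolding p q
      by (cases "rel_entropy \<rho> \<sigma>"; cases "rel_entropy (ptrace_snd r d \<rho>) (ptrace_snd r d \<sigma>)";
        cases "rel_entropy (id_tensor r d e R \<rho>) (id_tensor r d e R \<sigma>)") auto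
  qed
  then show "0 \<le> eta_Delta d e R" "eta_Delta d e R \<le> 1"
    unfolding eta_Delta_def by (intro sup_ratio_nonneg sup_ratio_le; force)+
qed

text \<open>The bound on the ratio in \<open>eta_Delta\<close>, cleared of its denominator and
  solved for the entropy after the channel.\<close>

lemma rel_entropy_eta_Delta:
  assumes R: "channel d e R" and r: "0 < r" and st: "state (r * d) \<rho>" "state (r * d) \<sigma>"
    and fin: "rel_entropy \<rho> \<sigma> < \<infinity>"
  shows "rel_entropy (id_tensor r d e R \<rho>) (id_tensor r d e R \<sigma>) \<le>
    eta_Delta d e R * rel_entropy \<rho> \<sigma> +
    (1 - eta_Delta d e R) * rel_entropy (ptrace_snd r d \<rho>) (ptrace_snd r d \<sigma>)"
proof -
  let ?\<eta> = "eta_Delta d e R"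
  note chain = rel_entropy_chain[OF R st]
  obtain x where x: "rel_entropy \<rho> \<sigma> = ereal x"
    using fin chain by (cases "rel_entropy \<rho> \<sigma>") auto
  obtain y where y: "rel_entropy (ptrace_snd r d \<rho>) (ptrace_snd r d \<sigma>) = ereal y"
    using chain x by (cases "rel_entropy (ptrace_snd r d \<rho>) (ptrace_snd r d \<sigma>)") auto
  obtain z where z: "rel_entropy (id_tensor r d e R \<rho>) (id_tensor r d e R \<sigma>) = ereal z"
    using chain x by (cases "rel_entropy (id_tensor r d e R \<rho>) (id_tensor r d e R \<sigma>)") auto
  obtain h where h: "?\<eta> = ereal h" using eta_Delta_bounds[OF R] by (cases ?\<eta>) auto
  have yzx: "y \<le> z" "z \<le> x" using chain x y z by auto
  have "z - y \<le> (x - y) * h"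
  \<comment> \<open>A zero denominator is excluded from the supremum; in that case
    \<open>y \<le> z \<le> x\<close> leaves nothing to gain.\<close>
  proof (cases "x = y")
    case True then show ?thesis using yzx by simp
  next
    case False
    have "ereal z - ereal y \<le> (ereal x - ereal y) * ?\<eta>" unfolding eta_Delta_def
      by (rule le_sup_ratio, unfold mem_Collect_eq, rule exI[of _ r], rule exI[of _ \<rho>], rule exI[of _ \<sigma>])
        (use False yzx r st in \<open>simp_all add: x y z\<close>)
    then show ?thesis by (simp add: h)
  qed
  then show ?thesis by (simp add: x y z h one_ereal_def algebra_simps)
qed

text \<open>Both inequalities of the theorem have this shape: three coefficients over one index set
  with a common denominator. The bounds by \<open>q\<close> confine the suprema for \<open>g\<close>
  and \<open>h\<close> to the interval from 0 to 1, so the arithmetic is real.\<close>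

lemma sup_ratio_convex_bound:
  fixes f g h q :: "'i \<Rightarrow> ereal" and \<eta> :: ereal
  assumes \<eta>: "0 \<le> \<eta>" "\<eta> \<le> 1"
    and bounds: "\<And>i. i \<in> I \<Longrightarrow> 0 \<le> g i \<and> g i \<le> q i" "\<And>i. i \<in> I \<Longrightarrow> 0 \<le> h i \<and> h i \<le> q i"
    and conv: "\<And>i. i \<in> I \<Longrightarrow> q i < \<infinity> \<Longrightarrow> f i \<le> \<eta> * g i + (1 - \<eta>) * h i"
  shows "sup_ratio ((\<lambda>i. (f i, q i)) ` I) \<le>
    \<eta> * sup_ratio ((\<lambda>i. (g i, q i)) ` I) + (1 - \<eta>) * sup_ratio ((\<lambda>i. (h i, q i)) ` I)"
proof -
  let ?G = "sup_ratio ((\<lambda>i. (g i, q i)) ` I)" and ?H = "sup_ratio ((\<lambda>i. (h i, q i)) ` I)"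
  have G: "0 \<le> ?G" "?G \<le> 1" using bounds(1) by (auto intro!: sup_ratio_nonneg sup_ratio_le)
  have H: "0 \<le> ?H" "?H \<le> 1" using bounds(2) by (auto intro!: sup_ratio_nonneg sup_ratio_le)
  obtain G' where G': "?G = ereal G'" using G by (cases ?G) auto
  obtain H' where H': "?H = ereal H'" using H by (cases ?H) auto
  obtain k where k: "\<eta> = ereal k" "0 \<le> k" "k \<le> 1" using \<eta> by (cases \<eta>) auto
  show ?thesis
  proof (rule sup_ratio_le)
    fix x y assume "(x, y) \<in> (\<lambda>i. (f i, q i)) ` I" and y: "0 < y" "y < \<infinity>"
    then obtain i where i: "i \<in> I" "x = f i" "y = q i" by blast
    obtain q' where q': "q i = ereal q'" using y i by (cases "q i") auto
    obtain g' where g': "g i = ereal g'" using bounds(1)[OF i(1)] q' by (cases "g i") auto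
    obtain h' where h': "h i = ereal h'" using bounds(2)[OF i(1)] q' by (cases "h i") auto
    have "g i \<le> q i * ?G" "h i \<le> q i * ?H" using i y by (auto intro!: le_sup_ratio)
    then have "g' \<le> q' * G'" "h' \<le> q' * H'" by (simp_all add: g' h' q' G' H')
    then have "k * g' + (1 - k) * h' \<le> k * (q' * G') + (1 - k) * (q' * H')"
      using k by (intro add_mono mult_left_mono) auto
    then have "\<eta> * g i + (1 - \<eta>) * h i \<le> q i * (\<eta> * ?G + (1 - \<eta>) * ?H)"
      by (simp add: k g' h' q' G' H' one_ereal_def algebra_simps)
    then show "x \<le> y * (\<eta> * ?G + (1 - \<eta>) * ?H)" using conv[OF i(1)] y i by (auto intro: order_trans)
  qed (use G H \<eta> in \<open>simp add: ereal_diff_positive\<close>)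
qed

lemma Collect_image_pair: "{f x y | x y. P x y} = (\<lambda>(x, y). f x y) ` {(x, y). P x y}"
  by auto

theorem mainTheorem14:
  fixes a b d e :: nat
    and M R N M\<^sub>B :: "complex mat \<Rightarrow> complex mat"
    and \<eta>\<^sub>R :: ereal
  assumes "0 < a" "0 < b" "0 < d" "0 < e"
    and "channel a (b * d) M"
    and "channel d e R"
    and "N = id_tensor b d e R \<circ> M"
    and "M\<^sub>B = ptrace_snd b d \<circ> M"
    and "\<eta>\<^sub>R = eta_Delta d e R"
  shows "eta_MI a (b * e) N \<le> \<eta>\<^sub>R * eta_MI a (b * d) M + (1 - \<eta>\<^sub>R) * eta_MI a b M\<^sub>B
       \<and> eta_D a N \<le> \<eta>\<^sub>R * eta_D a M + (1 - \<eta>\<^sub>R) * eta_D a M\<^sub>B"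
proof
  note M = assms(5) and R = assms(6)
  note Rb = channel_id_tensor[OF R, of b]
  have N: "channel a (b * e) N" unfolding assms(7) by (rule channel_comp[OF M Rb])
  have MB: "channel a b M\<^sub>B" unfolding assms(8) by (rule channel_comp[OF M channel_ptrace_snd])
  have \<eta>: "0 \<le> \<eta>\<^sub>R" "\<eta>\<^sub>R \<le> 1" unfolding assms(9) using eta_Delta_bounds[OF R] by auto
  have contr: "0 \<le> rel_entropy (T \<rho>) (T \<sigma>) \<and> rel_entropy (T \<rho>) (T \<sigma>) \<le> rel_entropy \<rho> \<sigma>"
    if "channel n m T" "state n \<rho>" "state n \<sigma>" for n m T \<rho> \<sigma>
    using rel_entropy_data_processing[OF that(1,3,2)] rel_entropy_nonneg channel_state[OF that(1)] that by blast

  let ?\<pi> = "\<lambda>c \<rho>. tensor_mat (ptrace_snd c a \<rho>) (ptrace_fst c a \<rho>)"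
  let ?I = "{(c, \<rho>). 0 < c \<and> state (c * a) \<rho>}"
  let ?f = "\<lambda>b T (c, \<rho>). rel_entropy (id_tensor c a b T \<rho>) (id_tensor c a b T (?\<pi> c \<rho>))"
  let ?q = "\<lambda>(c, \<rho>). mutual_info c a \<rho>"
  have \<pi>: "state (c * a) (?\<pi> c \<rho>)" if "state (c * a) \<rho>" for c \<rho>
    using channel_state[OF channel_ptrace_snd that] ptrace_fst_state[OF that] by (rule state_tensor_mat)
  \<comment> \<open>The three mutual information coefficients now share the index set
    \<open>?I\<close> and the denominator \<open>?q\<close>.\<close>
  have MI: "eta_MI a m T = sup_ratio ((\<lambda>i. (?f m T i, ?q i)) ` ?I)" if "channel a m T" for m T
    unfolding eta_MI_def mutual_info_id_tensor[OF that] Collect_image_pair by (simp add: case_prod_beta')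
  have bnd: "0 \<le> ?f m T i \<and> ?f m T i \<le> ?q i" if "channel a m T" "i \<in> ?I" for m T i
    using contr[OF channel_id_tensor[OF that(1)]] \<pi> that(2) by (auto simp: mutual_info_def)
  show "eta_MI a (b * e) N \<le> \<eta>\<^sub>R * eta_MI a (b * d) M + (1 - \<eta>\<^sub>R) * eta_MI a b M\<^sub>B"
    unfolding MI[OF N] MI[OF M] MI[OF MB]
  proof (rule sup_ratio_convex_bound[OF \<eta> bnd[OF M] bnd[OF MB]])
    fix i assume i: "i \<in> ?I" and fin: "?q i < \<infinity>"
    obtain c \<rho> where c: "i = (c, \<rho>)" "0 < c" "state (c * a) \<rho>" using i by auto
    let ?M = "id_tensor c a (b * d) M"
    \<comment> \<open>The reference \<open>C\<close> and the untouched output \<open>B\<close> merge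
      into one reference of dimension \<open>c * b\<close> for \<open>R\<close>.\<close>
    have idN: "id_tensor c a (b * e) N Z = id_tensor (c * b) d e R (?M Z)" for Z
      unfolding assms(7) id_tensor_comp[OF channel_funcset[OF M] channel_funcset[OF Rb]]
        id_tensor_id_tensor[OF channel_funcset[OF R]] ..
    have idMB: "id_tensor c a b M\<^sub>B Z = ptrace_snd (c * b) d (?M Z)" for Z
      unfolding assms(8) id_tensor_comp[OF channel_funcset[OF M] channel_funcset[OF channel_ptrace_snd]]
        id_tensor_ptrace_snd ..
    have st: "state (c * b * d) (?M \<rho>)" "state (c * b * d) (?M (?\<pi> c \<rho>))"
      using channel_state[OF channel_id_tensor[OF M, of c]] c(3) \<pi>[OF c(3)] by (simp_all add: mult.assoc)
    have "rel_entropy (?M \<rho>) (?M (?\<pi> c \<rho>)) < \<infinity>" using bnd[OF M i] fin c by (auto intro: le_less_trans)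
    \<comment> \<open>Positivity of \<open>b\<close> makes the merged reference admissible in
      \<open>eta_Delta\<close>.\<close>
    then show "?f (b * e) N i \<le> \<eta>\<^sub>R * ?f (b * d) M i + (1 - \<eta>\<^sub>R) * ?f b M\<^sub>B i"
      using rel_entropy_eta_Delta[OF R _ st] assms(2) c by (simp add: idN idMB assms(9))
  qed

  let ?I' = "{(\<rho>, \<sigma>). state a \<rho> \<and> state a \<sigma> \<and> \<rho> \<noteq> \<sigma>}"
  let ?f' = "\<lambda>T (\<rho>, \<sigma>). rel_entropy (T \<rho>) (T \<sigma>)"
  let ?q' = "\<lambda>(\<rho>, \<sigma>). rel_entropy \<rho> \<sigma>"
  have D: "eta_D a T = sup_ratio ((\<lambda>i. (?f' T i, ?q' i)) ` ?I')" for T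
    unfolding eta_D_def Collect_image_pair by (simp add: case_prod_beta')
  have bnd': "0 \<le> ?f' T i \<and> ?f' T i \<le> ?q' i" if "channel a m T" "i \<in> ?I'" for m T i
    using contr[OF that(1)] that(2) by auto
  show "eta_D a N \<le> \<eta>\<^sub>R * eta_D a M + (1 - \<eta>\<^sub>R) * eta_D a M\<^sub>B"
    unfolding D
  proof (rule sup_ratio_convex_bound[OF \<eta> bnd'[OF M] bnd'[OF MB]])
    fix i assume i: "i \<in> ?I'" and fin: "?q' i < \<infinity>"
    obtain \<rho> \<sigma> where s: "i = (\<rho>, \<sigma>)" "state a \<rho>" "state a \<sigma>" using i by auto
    have st: "state (b * d) (M \<rho>)" "state (b * d) (M \<sigma>)" using channel_state[OF M] s by auto
    \<comment> \<open>Data processing under \<open>M\<close> carries finiteness from the input pair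
      to the pair entering \<open>R\<close>; here the reference is \<open>B\<close> alone.\<close>
    have "rel_entropy (M \<rho>) (M \<sigma>) < \<infinity>" using bnd'[OF M i] fin s by (auto intro: le_less_trans)
    then show "?f' N i \<le> \<eta>\<^sub>R * ?f' M i + (1 - \<eta>\<^sub>R) * ?f' M\<^sub>B i"
      using rel_entropy_eta_Delta[OF R assms(2) st] s by (simp add: assms(7,8,9))
  qed
qed

end
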